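(* Let $n$ be a positive integer, $y\in I_n$ and $z\in I_n^{\mathsf{FPF}}$. The polynomial $2^{\kappa(y)}\hat{\mathfrak S}_y$ (respectively, $\hat{\mathfrak S}^{\mathsf{FPF}}_z$) is a positive integer linear combination of products of terms $x_i+x_j$ for $1\le i\le j\le n$ (respectively, $1\le i<j\le n$).
   Context: $[n]=\{1,\dots,n\}$; $S_n$ is the symmetric group, $s_i=(i,i+1)$, $\ell$ is Coxeter length. $I_n=\{w\in S_n:w=w^{-1}\}$; $I_n^{\mathsf{FPF}}$ is the set of $z\in I_n$ with $z(i)\ne i$ for all $i\in[n]$ (nonempty only if $n$ is even). $\kappa(y)$ is the number of 2-cycles of $y$. The Demazure product $\circ$ is the unique associative operation on $S_n$ with $s_i\circ s_i=s_i$ and $v\circ w=vw$ whenever $\ell(vw)=\ell(v)+\ell(w)$. $\mathcal A(y)$ is the set of minimal-length $w\in S_n$ with $y=w^{-1}\circ w$. For $n$ even, $1^{\mathsf{FPF}}_n=s_1s_3\cdots s_{n-1}$, and $\mathcal A^{\mathsf{FPF}}(z)$ is the set of minimal-length $w\in S_n$ with $z=w^{-1}1^{\mathsf{FPF}}_nw$. $\mathfrak S_w$ is the ordinary Schubert polynomial ($\mathfrak S_{n\cdots321}=x_1^{n-1}x_2^{n-2}\cdots x_{n-1}$ and $\mathfrak S_{ws_i}=\partial_i\mathfrak S_w$ if $w(i)>w(i+1)$, with $\partial_if=(f-s_if)/(x_i-x_{i+1})$). $\hat{\mathfrak S}_y=\sum_{w\in\mathcal A(y)}\mathfrak S_w$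 and $\hat{\mathfrak S}^{\mathsf{FPF}}_z=\sum_{w\in\mathcal A^{\mathsf{FPF}}(z)}\mathfrak S_w$. The empty product $1$ is allowed as a product of terms. *)

theory Defs
  imports
    "HOL-Library.Poly_Mapping"
    "HOL-Library.Multiset"
    "HOL-Combinatorics.Permutations"
begin

section \<open>Symmetric groups and Coxeter length\<close>

text \<open>
  Elements of \<open>S\<^sub>n\<close> are functions on \<^typ>\<open>nat\<close> that permute \<open>{1..n}\<close> and fix everything else.
  The group product \<open>v w\<close> is the composition \<open>v \<circ> w\<close>, so \<open>w s\<^sub>i\<close> interchanges the
  values \<open>w(i)\<close> and \<open>w(i+1)\<close>.
\<close>

definition Sym :: "nat \<Rightarrow> (nat \<Rightarrow> nat) set" where
  "Sym n = {w. w permutes {1..n}}"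

definition adj_transp :: "nat \<Rightarrow> nat \<Rightarrow> nat" where
  "adj_transp i = transpose i (i + 1)"

definition word_perm :: "nat list \<Rightarrow> nat \<Rightarrow> nat" where
  "word_perm is = foldr (\<circ>) (map adj_transp is) id"

definition cox_length :: "nat \<Rightarrow> (nat \<Rightarrow> nat) \<Rightarrow> nat" where
  "cox_length n w = (LEAST k. \<exists>is. length is = k \<and> set is \<subseteq> {1..<n} \<and> word_perm is = w)"

definition involutions :: "nat \<Rightarrow> (nat \<Rightarrow> nat) set" where
  "involutions n = {w \<in> Sym n. w = inv w}"

definition fpf_involutions :: "nat \<Rightarrow> (nat \<Rightarrow> nat) set" where
  "fpf_involutions n = {z \<in> involutions n. \<forall>i\<in>{1..n}. z i \<noteq> i}"

definition num_two_cycles :: "nat \<Rightarrow> (nat \<Rightarrow> nat) \<Rightarrow> nat" where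
  "num_two_cycles n y = card {(i, j). 1 \<le> i \<and> i < j \<and> j \<le> n \<and> y i = j \<and> y j = i}"


section \<open>Demazure product and atoms\<close>

definition is_demazure_product ::
    "nat \<Rightarrow> ((nat \<Rightarrow> nat) \<Rightarrow> (nat \<Rightarrow> nat) \<Rightarrow> (nat \<Rightarrow> nat)) \<Rightarrow> bool" where
  "is_demazure_product n d \<longleftrightarrow>
     (\<forall>u\<in>Sym n. \<forall>v\<in>Sym n. d u v \<in> Sym n) \<and>
     (\<forall>u\<in>Sym n. \<forall>v\<in>Sym n. \<forall>w\<in>Sym n. d (d u v) w = d u (d v w)) \<and>
     (\<forall>i\<in>{1..<n}. d (adj_transp i) (adj_transp i) = adj_transp i) \<and>
     (\<forall>v\<in>Sym n. \<forall>w\<in>Sym n.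
        cox_length n (v \<circ> w) = cox_length n v + cox_length n w \<longrightarrow> d v w = v \<circ> w)"

text \<open>
  These conditions determine the operation on \<open>S\<^sub>n \<times> S\<^sub>n\<close> only, hence \<open>SOME\<close> instead of \<open>THE\<close>;
  the values at other arguments are irrelevant and never used.
\<close>

definition demazure :: "nat \<Rightarrow> (nat \<Rightarrow> nat) \<Rightarrow> (nat \<Rightarrow> nat) \<Rightarrow> (nat \<Rightarrow> nat)" where
  "demazure n = (SOME d. is_demazure_product n d)"

definition min_length_elems :: "nat \<Rightarrow> (nat \<Rightarrow> nat) set \<Rightarrow> (nat \<Rightarrow> nat) set" where
  "min_length_elems n W = {w \<in> W. \<forall>v\<in>W. cox_length n w \<le> cox_length n v}"

definition atoms :: "nat \<Rightarrow> (nat \<Rightarrow> nat) \<Rightarrow> (nat \<Rightarrow> nat) set" where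
  "atoms n y = min_length_elems n {w \<in> Sym n. y = demazure n (inv w) w}"

definition one_fpf :: "nat \<Rightarrow> nat \<Rightarrow> nat" where
  "one_fpf n = word_perm (filter odd [1..<n])"

definition fpf_atoms :: "nat \<Rightarrow> (nat \<Rightarrow> nat) \<Rightarrow> (nat \<Rightarrow> nat) set" where
  "fpf_atoms n z = min_length_elems n {w \<in> Sym n. z = inv w \<circ> one_fpf n \<circ> w}"


section \<open>Schubert polynomials\<close>

text \<open>
  Polynomials over the integers in the variables \<open>x\<^sub>0, x\<^sub>1, \<dots>\<close> are finitely supported maps from
  monomials to coefficients, and monomials are finitely supported maps from variable
  indices to exponents.
\<close>

type_synonym int_mpoly = "(nat \<Rightarrow>\<^sub>0 nat) \<Rightarrow>\<^sub>0 int"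

definition var :: "nat \<Rightarrow> int_mpoly" where
  "var i = Poly_Mapping.single (Poly_Mapping.single i 1) 1"

text \<open>
  The action of \<open>s\<^sub>i\<close> on polynomials interchanges the variables \<open>x\<^sub>i\<close> and \<open>x\<^sub>i\<^sub>+\<^sub>1\<close>.  As
  \<^const>\<open>Poly_Mapping.map_key\<close> is precomposition, the inner one permutes the exponents of a
  monomial and the outer one the coefficients of the polynomial.
\<close>

definition swap_vars :: "nat \<Rightarrow> int_mpoly \<Rightarrow> int_mpoly" where
  "swap_vars i f = Poly_Mapping.map_key (Poly_Mapping.map_key (adj_transp i)) f"

text \<open>
  The quotient \<open>(f - s\<^sub>i f) / (x\<^sub>i - x\<^sub>i\<^sub>+\<^sub>1)\<close> always exists, and it is unique because
  \<^typ>\<open>int_mpoly\<close> is an integral domain.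
\<close>

definition divided_diff :: "nat \<Rightarrow> int_mpoly \<Rightarrow> int_mpoly" where
  "divided_diff i f = (THE g. (var i - var (i + 1)) * g = f - swap_vars i f)"

definition longest_perm :: "nat \<Rightarrow> nat \<Rightarrow> nat" where
  "longest_perm n i = (if i \<in> {1..n} then n + 1 - i else i)"

inductive is_schubert :: "nat \<Rightarrow> (nat \<Rightarrow> nat) \<Rightarrow> int_mpoly \<Rightarrow> bool" for n where
  longest: "is_schubert n (longest_perm n) (\<Prod>i\<in>{1..<n}. var i ^ (n - i))"
| descend: "is_schubert n w f \<Longrightarrow> i \<in> {1..<n} \<Longrightarrow> w i > w (i + 1) \<Longrightarrow>
    is_schubert n (w \<circ> adj_transp i) (divided_diff i f)"

text \<open>
  Every \<open>w \<in> S\<^sub>n\<close> is reached from the longest element, and the result does not depend on the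
  path, as the divided differences satisfy the braid relations.
\<close>

definition schubert :: "nat \<Rightarrow> (nat \<Rightarrow> nat) \<Rightarrow> int_mpoly" where
  "schubert n w = (THE f. is_schubert n w f)"

definition inv_schubert :: "nat \<Rightarrow> (nat \<Rightarrow> nat) \<Rightarrow> int_mpoly" where
  "inv_schubert n y = (\<Sum>w\<in>atoms n y. schubert n w)"

definition fpf_schubert :: "nat \<Rightarrow> (nat \<Rightarrow> nat) \<Rightarrow> int_mpoly" where
  "fpf_schubert n z = (\<Sum>w\<in>fpf_atoms n z. schubert n w)"


section \<open>Positive combinations of products\<close>

definition products :: "'a::comm_monoid_mult set \<Rightarrow> 'a set" where
  "products G = {\<Prod>\<^sub># M | M. set_mset M \<subseteq> G}"

text \<open>The combination has at least one summand, so \<open>0\<close> does not qualify trivially.\<close>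

definition positive_int_combination :: "'a::comm_ring_1 set \<Rightarrow> 'a \<Rightarrow> bool" where
  "positive_int_combination P f \<longleftrightarrow>
     (\<exists>T c. finite T \<and> T \<noteq> {} \<and> T \<subseteq> P \<and> (\<forall>t\<in>T. (c t :: int) > 0) \<and>
        f = (\<Sum>t\<in>T. of_int (c t) * t))"

end

(*
  In the module of involutions over the nil-Coxeter algebra (a generator u_i sends y to the Demazure
  conjugate of y by s_i if that is longer, and to 0 otherwise) the polynomial attached to y is the
  coefficient of y in 1 S, where S = A_1(x_1) ... A_{n-1}(x_{n-1}) with A_i(x) = h_{n-1}(x) ... h_i(x) and
  h_i(x) = 1 + x u_i is the Fomin-Stanley product for Schubert polynomials.  The Yang-Baxter relation
  h_i(x) h_{i+1}(x+y) h_i(y) = h_{i+1}(y) h_i(x+y) h_{i+1}(x) gives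
    (h_i(x) ... h_{n-1}(x)) A_i(y) = A_{i+1}(y) h_i(x+y) (h_{i+1}(x) ... h_{n-1}(x)),
  and the vector 1 satisfies 1 A_i(x) = 1 h_i(x) ... h_{n-1}(x).  Using both, S can be folded: its factors
  pair up into h_j(x_k + x_l) with k < l, preceded by the unpaired factors h_{2k-1}(x_k).  An unpaired
  factor that contributes always creates a new 2-cycle, so the power of 2 turns its weight x_k into
  x_k + x_k.  In the fixed-point-free case nothing remains unpaired.
*)

theory Submission
  imports Defs
begin

section \<open>Divided differences\<close>

text \<open>\<open>demazure\<close> is a choice and \<open>schubert\<close> a description, so both
  must be realised before anything can be computed. The Demazure product is assembled from commuting
  left and right 0-Hecke operators. The Fomin-Stanley coefficients satisfy all divided difference
  recursions at once, which settles independence of the path.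

  The Yang-Baxter relation is verified in the regular module of the nil-Coxeter algebra, whereas
  turning a string around at the vector 1 is possible only in the module of involutions. The
  computation therefore runs on functions on the symmetric group, and summation over atoms is a map
  to the smaller module that commutes with the operators. Strings turn around because s_i s_(i+1)
  and s_(i+1) s_i are atoms of the same involution, the transposition of i and i+2. In the
  fixed-point-free case odd generators kill 1, and u_(p+1) u_p and u_(p+1) u_(p+2) agree on 1 for
  odd p; hence a string starting at an odd index loses that index when it turns.

  Folding yields only nonnegative combinations. That they are not empty is a separate fact: divided
  differences lead from every polynomial down to that of the base point, which is 1.\<close>

lemma adj_transp_apply:
  "adj_transp i k = (if k = i then i + 1 else if k = i + 1 then i else k)"
  by (simp add: adj_transp_def transpose_def)

lemma adj_transp_involutory [simp]: "adj_transp i (adj_transp i k) = k"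
  by (simp add: adj_transp_def)

lemma adj_transp_comp_self [simp]: "adj_transp i \<circ> adj_transp i = id"
  by (simp add: adj_transp_def)

lemma inj_adj_transp [simp]: "inj (adj_transp i)"
  by (simp add: adj_transp_def)

lemma inv_adj_transp [simp]: "inv (adj_transp i) = adj_transp i"
  by (simp add: adj_transp_def)

text \<open>\<open>map_key\<close> acts as precomposition only for injective key maps. The keys of
  the outer map in \<open>swap_vars\<close> are monomials, so the renaming of monomials itself has
  to be injective.\<close>

lemma inj_map_key_adj_transp:
  "inj (Poly_Mapping.map_key (adj_transp i) :: (nat \<Rightarrow>\<^sub>0 'a::zero) \<Rightarrow> _)"
proof (rule injI)
  fix p q :: "nat \<Rightarrow>\<^sub>0 'a"
  assume "Poly_Mapping.map_key (adj_transp i) p = Poly_Mapping.map_key (adj_transp i) q"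
  then have "Poly_Mapping.map_key (adj_transp i) (Poly_Mapping.map_key (adj_transp i) p) =
      Poly_Mapping.map_key (adj_transp i) (Poly_Mapping.map_key (adj_transp i) q)"
    by simp
  then show "p = q"
    by (simp add: map_key_compose id_def map_key_id)
qed

lemma map_key_adj_transp_involutory [simp]:
  "Poly_Mapping.map_key (adj_transp i) (Poly_Mapping.map_key (adj_transp i) p) = p"
  by (simp add: map_key_compose id_def map_key_id)

lemma swap_vars_single:
  "swap_vars i (Poly_Mapping.single m c) =
     Poly_Mapping.single (Poly_Mapping.map_key (adj_transp i) m) c"
  using map_key_single[OF inj_map_key_adj_transp[of i], of "Poly_Mapping.map_key (adj_transp i) m" c]
  by (simp add: swap_vars_def)

lemma swap_vars_zero [simp]: "swap_vars i 0 = 0"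
  by (simp add: swap_vars_def map_key_zero inj_map_key_adj_transp)

lemma swap_vars_add: "swap_vars i (f + g) = swap_vars i f + swap_vars i g"
  by (simp add: swap_vars_def map_key_plus inj_map_key_adj_transp)

lemma swap_vars_one [simp]: "swap_vars i 1 = 1"
  using swap_vars_single[of i 0 1] by (simp add: map_key_zero)

lemma int_mpoly_induct [case_names add single]:
  fixes f :: int_mpoly
  assumes "\<And>f g. P f \<Longrightarrow> P g \<Longrightarrow> P (f + g)" and "\<And>m c. P (Poly_Mapping.single m c)"
  shows "P f"
proof (induction f rule: update_induct)
  case const
  show ?case using assms(2)[of 0 0] by simp
next
  case (update f k v)
  then have "Poly_Mapping.update k v f = Poly_Mapping.single k v + f"
    by (intro poly_mapping_eqI) (auto simp: lookup_update lookup_add lookup_single in_keys_iff)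
  then show ?case using assms update by simp
qed

lemma swap_vars_mult: "swap_vars i (f * g) = swap_vars i f * swap_vars i g"
proof (induction f rule: int_mpoly_induct)
  case (add f f')
  then show ?case by (simp add: distrib_right swap_vars_add)
next
  case (single m c)
  show ?case
  proof (induction g rule: int_mpoly_induct)
    case (add f f')
    then show ?case by (simp add: distrib_left swap_vars_add)
  next
    case (single m' c')
    show ?case
      by (simp add: mult_single swap_vars_single map_key_plus)
  qed
qed

lemma swap_vars_var: "swap_vars i (var k) = var (adj_transp i k)"
proof -
  have "Poly_Mapping.map_key (adj_transp i) (Poly_Mapping.single k (1::nat)) =
      Poly_Mapping.single (adj_transp i k) 1"
    using map_key_single[OF inj_adj_transp[of i], of "adj_transp i k" "1::nat"] by simp
  then show ?thesis
    by (simp add: var_def swap_vars_single)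
qed

lemma swap_vars_sum: "swap_vars i (sum f A) = (\<Sum>a\<in>A. swap_vars i (f a))"
  by (induction A rule: infinite_finite_induct) (simp_all add: swap_vars_add)

text \<open>Makes \<open>var i - var (i + 1)\<close> nonzero, hence cancellable in an integral
  domain.\<close>

lemma var_inject [simp]: "var i = var j \<longleftrightarrow> i = j"
proof -
  have "i = j" if "var i = var j"
  proof -
    have "Poly_Mapping.keys (var i) = Poly_Mapping.keys (var j)"
      using that by simp
    then have "Poly_Mapping.keys (Poly_Mapping.single i (1::nat)) = Poly_Mapping.keys (Poly_Mapping.single j (1::nat))"
      by (simp add: var_def)
    then show ?thesis by simp
  qed
  then show ?thesis by auto
qed

lemma divided_diff_eqI:
  assumes "(var i - var (i + 1)) * g = f - swap_vars i f"
  shows "divided_diff i f = g"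
  unfolding divided_diff_def
proof (rule the_equality)
  fix h assume "(var i - var (i + 1)) * h = f - swap_vars i f"
  with assms have "(var i - var (i + 1)) * h = (var i - var (i + 1)) * g"
    by simp
  then show "h = g" by simp
qed (rule assms)


section \<open>Yang--Baxter operators\<close>

text \<open>Vectors are coefficient functions, and \<open>U i\<close> acts on them. Linearity alone
  suffices for \<open>step\<close> and \<open>run\<close>, so the module of involutions can share
  them: the relations are exploited in the regular module and transported from there.\<close>

locale linear_ops =
  fixes U :: "nat \<Rightarrow> ('b \<Rightarrow> 'r::comm_ring_1) \<Rightarrow> 'b \<Rightarrow> 'r"
  assumes U_lin: "U i (\<lambda>b. f b + c * g b) = (\<lambda>b. U i f b + c * U i g b)"
begin

definition step :: "nat \<Rightarrow> 'r \<Rightarrow> ('b \<Rightarrow> 'r) \<Rightarrow> 'b \<Rightarrow> 'r" where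
  "step i x f = (\<lambda>b. f b + x * U i f b)"

text \<open>\<open>step i x\<close> is the factor h_i(x). The head of the list acts first, so a list
  is read in the order of a product acting from the right.\<close>

definition run :: "(nat \<times> 'r) list \<Rightarrow> ('b \<Rightarrow> 'r) \<Rightarrow> 'b \<Rightarrow> 'r" where
  "run L = fold (\<lambda>(i, x). step i x) L"

lemma run_simps [simp]:
  "run [] f = f" "run ((i, x) # L) f = run L (step i x f)" "run (L @ M) f = run M (run L f)"
  by (simp_all add: run_def)

lemma U_zero: "U i (\<lambda>b. 0) = (\<lambda>b. 0)"
  using U_lin[of i "\<lambda>b. 0" "- 1" "\<lambda>b. 0"] by simp

lemma step_lin: "step i x (\<lambda>b. f b + c * g b) = (\<lambda>b. step i x f b + c * step i x g b)"
  by (simp add: step_def U_lin algebra_simps)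

lemma run_lin: "run L (\<lambda>b. f b + c * g b) = (\<lambda>b. run L f b + c * run L g b)"
  by (induction L arbitrary: f g) (auto simp: step_lin)

end

text \<open>\<open>U_vanish\<close> makes every factor with an index from \<open>n\<close> on
  trivial, so recursions along a string need no special case at its upper end.\<close>

locale nil_coxeter = linear_ops U for U :: "nat \<Rightarrow> ('b \<Rightarrow> 'r::comm_ring_1) \<Rightarrow> 'b \<Rightarrow> 'r" +
  fixes n :: nat
  assumes U_square: "U i (U i f) = (\<lambda>b. 0)"
    and U_commute: "i + 1 < j \<Longrightarrow> U i (U j f) = U j (U i f)"
    and U_braid: "U i (U (i + 1) (U i f)) = U (i + 1) (U i (U (i + 1) f))"
    and U_vanish: "n \<le> i \<Longrightarrow> U i f = (\<lambda>b. 0)"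
begin

text \<open>\<open>down i x\<close> is the string A_i(x), and \<open>up i x\<close> is the same
  product in reverse order.\<close>

definition up :: "nat \<Rightarrow> 'r \<Rightarrow> (nat \<times> 'r) list" where
  "up i x = map (\<lambda>j. (j, x)) [i..<n]"

definition down :: "nat \<Rightarrow> 'r \<Rightarrow> (nat \<times> 'r) list" where
  "down i x = map (\<lambda>j. (j, x)) (rev [i..<n])"

lemma up_rec: "i < n \<Longrightarrow> up i x = (i, x) # up (i + 1) x"
  by (simp add: up_def upt_conv_Cons)

lemma down_rec: "i < n \<Longrightarrow> down i x = down (i + 1) x @ [(i, x)]"
  by (simp add: down_def upt_conv_Cons)

lemma up_empty: "n \<le> i \<Longrightarrow> up i x = []"
  by (simp add: up_def)

lemma down_empty: "n \<le> i \<Longrightarrow> down i x = []"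
  by (simp add: down_def)

lemma step_vanish: "n \<le> i \<Longrightarrow> step i x f = f"
  by (simp add: step_def U_vanish)

lemma run_up_rec: "run (up i x) f = run (up (i + 1) x) (step i x f)"
  by (cases "i < n") (simp_all add: up_rec up_empty step_vanish)

lemma run_down_rec: "run (down i x) f = step i x (run (down (i + 1) x) f)"
  by (cases "i < n") (simp_all add: down_rec down_empty step_vanish)

lemma step_commute:
  assumes "i + 1 < j \<or> j + 1 < i"
  shows "step i x (step j y f) = step j y (step i x f)"
proof -
  have "U i (U j f) = U j (U i f)"
    using assms U_commute[of i j f] U_commute[of j i f] by auto
  then show ?thesis
    by (simp add: step_def U_lin algebra_simps)
qed

lemma step_add: "step i x (step i y f) = step i (x + y) f"
  by (simp add: step_def U_lin U_square algebra_simps)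

lemma step_zero: "step i 0 f = f"
  by (simp add: step_def)

text \<open>Expand both sides: \<open>U_square\<close> removes the repeated quadratic terms, the
  linear and the mixed quadratic coefficients agree, and the cubic terms, both with coefficient
  \<open>x * (x + y) * y\<close>, match by the braid relation.\<close>

lemma yang_baxter:
  "step i x (step (i + 1) (x + y) (step i y f)) =
   step (i + 1) y (step i (x + y) (step (i + 1) x f))"
proof
  fix b
  show "step i x (step (i + 1) (x + y) (step i y f)) b =
      step (i + 1) y (step i (x + y) (step (i + 1) x f)) b"
    unfolding step_def U_lin U_square U_zero U_braid[of i f, symmetric]
    by (simp add: algebra_simps)
qed

lemma run_step_commute:
  assumes "\<And>a. a \<in> fst ` set L \<Longrightarrow> i + 1 < a \<or> a + 1 < i"
  shows "run L (step i x f) = step i x (run L f)"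
  using assms
proof (induction L arbitrary: f)
  case (Cons p L)
  obtain a y where p: "p = (a, y)" by fastforce
  have "step a y (step i x f) = step i x (step a y f)"
    by (rule step_commute) (use Cons.prems p in auto)
  with Cons show ?case
    by (simp add: p)
qed simp

lemma run_run_commute:
  assumes "\<And>a b. a \<in> fst ` set L \<Longrightarrow> b \<in> fst ` set M \<Longrightarrow> a + 1 < b \<or> b + 1 < a"
  shows "run L (run M f) = run M (run L f)"
  using assms
proof (induction M arbitrary: f)
  case (Cons p M)
  obtain a y where p: "p = (a, y)" by fastforce
  have "run L (step a y f) = step a y (run L f)"
    by (rule run_step_commute) (use Cons.prems p in force)
  with Cons show ?case
    by (simp add: p)
qed simp

lemma fst_set_up: "fst ` set (up i x) = {i..<n}"
  by (force simp: up_def)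

lemma fst_set_down: "fst ` set (down i x) = {i..<n}"
  by (force simp: down_def)

text \<open>Induction from the top end. The strings above \<open>i\<close> interact by hypothesis
  through one factor at \<open>i + 1\<close>; the two outer factors at \<open>i\<close> commute with
  everything from \<open>i + 2\<close> on and close in on it, which is the Yang-Baxter
  pattern.\<close>

lemma run_up_down:
  "run (down i y) (run (up i x) f) = run (up (i + 1) x) (step i (x + y) (run (down (i + 1) y) f))"
proof (induction "n - i" arbitrary: i f)
  case 0
  then show ?case by (simp add: up_empty down_empty step_vanish)
next
  case (Suc m)
  have comm_down: "run (down (i + 2) y) (step i x f) = step i x (run (down (i + 2) y) f)"
    by (rule run_step_commute) (use fst_set_down in auto)
  have comm_up: "run (up (i + 2) x) (step i y g) = step i y (run (up (i + 2) x) g)" for g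
    by (rule run_step_commute) (use fst_set_up in auto)
  have "run (down i y) (run (up i x) f) =
      step i y (run (down (i + 1) y) (run (up (i + 1) x) (step i x f)))"
    by (simp only: run_up_rec[of i] run_down_rec[of i])
  also have "\<dots> = step i y (run (up (i + 2) x) (step (i + 1) (x + y) (run (down (i + 2) y) (step i x f))))"
    using Suc(1)[of "i + 1" "step i x f"] Suc(2) by (simp add: numeral_2_eq_2)
  also have "\<dots> = run (up (i + 2) x)
      (step i y (step (i + 1) (y + x) (step i x (run (down (i + 2) y) f))))"
    by (simp only: comm_down comm_up add.commute)
  also have "\<dots> = run (up (i + 2) x)
      (step (i + 1) x (step i (y + x) (step (i + 1) y (run (down (i + 2) y) f))))"
    by (simp only: yang_baxter)
  also have "\<dots> = run (up (i + 1) x) (step i (x + y) (run (down (i + 1) y) f))"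
    by (simp only: run_up_rec[of "i + 1"] run_down_rec[of "i + 1"] add.commute[of y]
        add.assoc one_add_one)
  finally show ?case .
qed

lemma run_down_inverse: "run (up i (- x)) (run (down i x) f) = f"
proof (induction "n - i" arbitrary: i f)
  case 0
  then show ?case by (simp add: up_empty down_empty)
next
  case (Suc m)
  then show ?case
    by (simp add: run_up_rec[of i] run_down_rec[of i] step_add step_zero)
qed

text \<open>An ascending string with parameter \<open>- x\<close> inverts a descending one with
  \<open>x\<close>. By \<open>run_up_down\<close> it commutes with a descending string, because the
  middle factor with parameter \<open>- x + y\<close> splits; commuting with an inverse means
  commuting with the element. This is the source of all symmetry in the variables.\<close>

lemma run_down_commute: "run (down i x) (run (down i y) f) = run (down i y) (run (down i x) f)"
proof -
  have swap: "run (down i y) (run (up i (- x)) g) = run (up i (- x)) (run (down i y) g)" for g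
    by (simp only: run_up_down run_up_rec[of i _ "step i y f" for f] run_down_rec[of i _ g] step_add)
  have "run (down i y) f = run (up i (- x)) (run (down i y) (run (down i x) f))"
    by (simp add: run_down_inverse flip: swap)
  moreover have "run (down i x) (run (up i (- x)) g) = g" for g
    by (simp add: run_up_down run_down_inverse step_zero)
  ultimately show ?thesis
    by metis
qed

end

section \<open>Folding the staircase\<close>

context nil_coxeter
begin

text \<open>What the \<open>j\<close>-th string has become once \<open>k\<close> variables are
  folded: one factor for each pair of \<open>j\<close> with a later \<open>l\<close>, then the still
  unpaired tail. Each new variable consumes the first letter \<open>j + k\<close> of that
  tail.\<close>

definition block :: "(nat \<Rightarrow> 'r) \<Rightarrow> nat \<Rightarrow> nat \<Rightarrow> (nat \<times> 'r) list" where
  "block x j k = map (\<lambda>l. (j + l - 1, x j + x l)) [j + 1..<k + 1] @ up (j + k) (x j)"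

definition blocks :: "(nat \<Rightarrow> 'r) \<Rightarrow> nat \<Rightarrow> nat \<Rightarrow> (nat \<times> 'r) list" where
  "blocks x m k = concat (map (\<lambda>j. block x j k) (rev [1..<m + 1]))"

definition stair :: "(nat \<Rightarrow> 'r) \<Rightarrow> nat \<Rightarrow> (nat \<times> 'r) list" where
  "stair x k = concat (map (\<lambda>i. down i (x i)) [1..<k + 1])"

text \<open>\<open>run_up_down\<close> acts on the tail of the block and spends the lowest letter of
  the descending string. The paired letters are at most \<open>k + j - 1\<close>, so the rest of
  that string, which begins at \<open>k + j + 1\<close>, passes them.\<close>

lemma run_down_block:
  assumes "1 \<le> j" "j \<le> k"
  shows "run (down (k + j) (x (k + 1))) (run (block x j k) f) =
    run (block x j (k + 1)) (run (down (k + j + 1) (x (k + 1))) f)"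
proof -
  define M where "M = map (\<lambda>l. (j + l - 1, x j + x l)) [j + 1..<k + 1]"
  have comm: "run (down (k + j + 1) y) (run M f) = run M (run (down (k + j + 1) y) f)" for y
    by (rule run_run_commute) (use assms fst_set_down in \<open>auto simp: M_def\<close>)
  have "[j + 1..<k + 2] = [j + 1..<k + 1] @ [k + 1]"
    using assms by (simp add: numeral_2_eq_2)
  then have "block x j (k + 1) = M @ (k + j, x j + x (k + 1)) # up (k + j + 1) (x j)"
    by (simp add: block_def M_def add.commute add.left_commute)
  moreover have "block x j k = M @ up (k + j) (x j)"
    by (simp add: block_def M_def add.commute)
  ultimately show ?thesis
    using comm by (simp add: run_up_down)
qed

lemma blocks_Suc: "blocks x (Suc m) k = block x (Suc m) k @ blocks x m k"
  by (simp add: blocks_def)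

text \<open>Every block costs the string its lowest letter, so \<open>m\<close> blocks raise its
  start by \<open>m\<close>. With \<open>m = k\<close> it reaches the vector with lowest letter
  \<open>2 * k + 1\<close>.\<close>

lemma run_down_blocks:
  assumes "m \<le> k"
  shows "run (down (k + 1) (x (k + 1))) (run (blocks x m k) f) =
    run (blocks x m (k + 1)) (run (down (k + m + 1) (x (k + 1))) f)"
  using assms
proof (induction m arbitrary: f)
  case 0
  then show ?case by (simp add: blocks_def)
next
  case (Suc m)
  then show ?case
    using run_down_block[of "Suc m" k x f] by (simp add: blocks_Suc)
qed

lemma stair_Suc: "stair x (Suc k) = stair x k @ down (Suc k) (x (Suc k))"
  by (simp add: stair_def)

text \<open>
  Think of \<open>\<Phi>\<close> as the projection to a quotient in which a decreasing run of generators acting on a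
  suitable vector may be turned into an increasing one.
\<close>

lemma stair_fold:
  fixes \<Phi> :: "('b \<Rightarrow> 'r) \<Rightarrow> 'c"
  assumes cong: "\<And>L f g. \<Phi> f = \<Phi> g \<Longrightarrow> \<Phi> (run L f) = \<Phi> (run L g)"
    and turn: "\<And>k. \<Phi> (run (down (2 * k + 1) (x (k + 1))) (v k)) =
                    \<Phi> (run (up (2 * k + 2) (x (k + 1))) (v (k + 1)))"
  shows "\<Phi> (run (stair x k) (v 0)) = \<Phi> (run (blocks x k k) (v k))"
proof (induction k)
  case 0
  then show ?case by (simp add: stair_def blocks_def)
next
  case (Suc k)
  have "\<Phi> (run (stair x (Suc k)) (v 0)) = \<Phi> (run (down (k + 1) (x (k + 1))) (run (blocks x k k) (v k)))"
    using cong[OF Suc] by (simp add: stair_Suc)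
  also have "\<dots> = \<Phi> (run (blocks x k (k + 1)) (run (down (2 * k + 1) (x (k + 1))) (v k)))"
    by (simp only: run_down_blocks[OF order_refl] mult_2)
  also have "\<dots> = \<Phi> (run (blocks x k (k + 1)) (run (up (2 * k + 2) (x (k + 1))) (v (k + 1))))"
    by (rule cong[OF turn])
  \<comment> \<open>The turned string is itself the block of \<open>k + 1\<close> at stage
    \<open>k + 1\<close>: it has no later partner yet, and its tail begins at twice
    \<open>k + 1\<close>.\<close>
  also have "\<dots> = \<Phi> (run (blocks x (Suc k) (Suc k)) (v (Suc k)))"
    by (simp add: blocks_Suc block_def mult_2)
  finally show ?case .
qed

lemma map_hom_down: "map (apsnd \<tau>) (down i x) = down i (\<tau> x)"
  by (simp add: down_def)

lemma run_hom:
  assumes add: "\<And>x y. \<tau> (x + y) = \<tau> x + \<tau> y" and mult: "\<And>x y. \<tau> (x * y) = \<tau> x * \<tau> y"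
    and equiv: "\<And>j f. U j (\<tau> \<circ> f) = \<tau> \<circ> U j f"
  shows "\<tau> \<circ> run L f = run (map (apsnd \<tau>) L) (\<tau> \<circ> f)"
proof (induction L arbitrary: f)
  case (Cons p L)
  obtain j y where p: "p = (j, y)" by fastforce
  have "\<tau> \<circ> step j y f = step j (\<tau> y) (\<tau> \<circ> f)"
    unfolding step_def equiv by (simp add: fun_eq_iff add mult)
  then show ?case
    by (simp only: p run_simps list.map apsnd_conv Cons)
qed simp

text \<open>Exchanging two adjacent variables affects only the strings at \<open>i\<close> and
  \<open>i + 1\<close>. These fall short of a symmetric product by a single factor at
  \<open>i\<close>, and this defect is a multiple of \<open>U i\<close>, which commutes with all
  later strings.\<close>

lemma stair_divided_difference:
  assumes add: "\<And>x y. \<tau> (x + y) = \<tau> x + \<tau> y" and mult: "\<And>x y. \<tau> (x * y) = \<tau> x * \<tau> y"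
    and equiv: "\<And>j f. U j (\<tau> \<circ> f) = \<tau> \<circ> U j f"
    and x: "\<And>j. \<tau> (x j) = x (adj_transp i j)" and e: "\<tau> \<circ> e = e"
    and i: "1 \<le> i" "i < n"
  shows "(x i - x (i + 1)) * U i (run (stair x n) e) b = run (stair x n) e b - \<tau> (run (stair x n) e b)"
proof -
  have hom: "\<tau> \<circ> run L f = run (map (apsnd \<tau>) L) (\<tau> \<circ> f)" for L f
    by (rule run_hom) (fact add mult equiv)+
  define L where "L = concat (map (\<lambda>i. down i (x i)) [1..<i])"
  define R where "R = concat (map (\<lambda>i. down i (x i)) [i + 2..<n + 1])"
  have "[1..<n + 1] = [1..<i] @ [i..<n + 1]"
    using i upt_add_eq_append[of 1 i "n + 1 - i"] by simp
  also have "[i..<n + 1] = i # (i + 1) # [i + 2..<n + 1]"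
    using i by (simp add: upt_conv_Cons numeral_2_eq_2)
  finally have stair: "stair x n = L @ down i (x i) @ down (i + 1) (x (i + 1)) @ R"
    by (simp add: stair_def L_def R_def)
  define v where "v = run L e"
  define g where "g = run (down (i + 1) (x (i + 1))) (run (down i (x i)) v)"
  \<comment> \<open>The missing factor \<open>step i (x (i + 1))\<close> completes the second
    string, so that \<open>s\<close> is a product of two full strings from \<open>i\<close> and
    invariant under \<open>\<tau>\<close>.\<close>
  define s where "s = run (down i (x (i + 1))) (run (down i (x i)) v)"
  have "map (apsnd \<tau>) L = L"
    by (auto simp: L_def map_concat map_hom_down x adj_transp_apply intro!: arg_cong[of _ _ concat])
  then have v: "\<tau> \<circ> v = v"
    by (simp add: v_def hom e)
  have R: "map (apsnd \<tau>) R = R"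
    by (auto simp: R_def map_concat map_hom_down x adj_transp_apply intro!: arg_cong[of _ _ concat])
  have s_g: "s = step i (x (i + 1)) g"
    unfolding s_def g_def by (rule run_down_rec)
  then have "U i s = U i g"
    by (simp add: step_def U_lin U_square)
  then have g: "g b = s b - x (i + 1) * U i s b" for b
    using s_g by (simp add: step_def)
  have s: "\<tau> \<circ> s = s"
    unfolding s_def hom map_hom_down v x adj_transp_apply
    by (simp add: run_down_commute)
  \<comment> \<open>Apply \<open>\<tau>\<close> to the expression of \<open>s\<close> as
    \<open>g\<close> plus a multiple of \<open>U i s\<close>: both \<open>s\<close> and
    \<open>U i s\<close> are invariant, and only the scalar changes.\<close>
  have "\<tau> (g b) = g b - (x i - x (i + 1)) * U i g b" for b
  proof -
    have "\<tau> (s b) = \<tau> (g b) + \<tau> (x (i + 1)) * \<tau> (U i s b)"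
      by (simp add: g flip: add mult)
    moreover have "\<tau> (s b) = s b"
      using fun_cong[OF s, of b] by (simp only: comp_apply)
    moreover have "\<tau> (U i s b) = U i s b"
      using fun_cong[OF equiv[of i s, symmetric], of b] unfolding s comp_apply .
    moreover have "s b = g b + x (i + 1) * U i g b"
      using s_g by (simp add: step_def)
    ultimately show ?thesis
      using \<open>U i s = U i g\<close> x[of "i + 1"] by (simp add: adj_transp_apply algebra_simps)
  qed
  then have "\<tau> \<circ> g = (\<lambda>b. g b + (x (i + 1) - x i) * U i g b)"
    by (intro ext) (simp only: comp_apply left_diff_distrib, simp)
  then have "\<tau> \<circ> run R g = run R (\<lambda>b. g b + (x (i + 1) - x i) * U i g b)"
    by (simp only: hom R)
  also have "\<dots> = (\<lambda>b. run R g b + (x (i + 1) - x i) * run R (U i g) b)"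
    by (rule run_lin)
  also have "run R (U i g) = U i (run R g)"
  proof -
    have "i + 1 < a" if "a \<in> fst ` set R" for a
      using that by (auto simp: R_def down_def)
    \<comment> \<open>With parameter 1 the factor is the identity plus \<open>U i\<close>, so
      commuting with it is commuting with \<open>U i\<close>.\<close>
    then have "run R (step i 1 g) = step i 1 (run R g)"
      by (intro run_step_commute) auto
    moreover have "run R (step i 1 g) = (\<lambda>b. run R g b + 1 * run R (U i g) b)"
      unfolding step_def by (rule run_lin)
    ultimately have "run R g b + run R (U i g) b = run R g b + U i (run R g) b" for b
      by (metis mult_1 step_def)
    then show ?thesis
      by (intro ext) simp
  qed
  also have "run R g = run (stair x n) e"
    by (simp add: stair g_def v_def)
  finally have "\<tau> \<circ> run (stair x n) e =
      (\<lambda>b. run (stair x n) e b + (x (i + 1) - x i) * U i (run (stair x n) e) b)" .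
  from fun_cong[OF this, of b] show ?thesis
    by (simp add: algebra_simps)
qed

end

section \<open>Inversions and Coxeter length\<close>

lemma Sym_id [simp]: "id \<in> Sym n"
  by (simp add: Sym_def permutes_id)

lemma Sym_comp: "v \<in> Sym n \<Longrightarrow> w \<in> Sym n \<Longrightarrow> v \<circ> w \<in> Sym n"
  by (simp add: Sym_def permutes_compose)

lemma Sym_inv: "w \<in> Sym n \<Longrightarrow> inv w \<in> Sym n"
  by (simp add: Sym_def permutes_inv)

lemma Sym_adj_transp: "i \<in> {1..<n} \<Longrightarrow> adj_transp i \<in> Sym n"
  by (auto simp: Sym_def adj_transp_def intro!: permutes_swap_id)

lemma Sym_inj: "w \<in> Sym n \<Longrightarrow> w a = w b \<longleftrightarrow> a = b"
  by (metis Sym_def mem_Collect_eq permutes_def)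

lemma Sym_bij: "w \<in> Sym n \<Longrightarrow> bij w"
  by (simp add: Sym_def permutes_bij)

lemma Sym_inv_inv: "w \<in> Sym n \<Longrightarrow> inv (inv w) = w"
  by (simp add: Sym_def permutes_inv_inv)

lemma Sym_inv_apply: "w \<in> Sym n \<Longrightarrow> w (inv w a) = a" "w \<in> Sym n \<Longrightarrow> inv w (w a) = a"
  by (simp_all add: Sym_def permutes_inverses)

lemma Sym_inv_comp_adj: "w \<in> Sym n \<Longrightarrow> inv (w \<circ> adj_transp i) = adj_transp i \<circ> inv w"
  by (metis o_inv_distrib Sym_bij adj_transp_def bij_transpose inv_adj_transp)

lemma Sym_inv_adj_comp: "w \<in> Sym n \<Longrightarrow> inv (adj_transp i \<circ> w) = inv w \<circ> adj_transp i"
  by (metis o_inv_distrib Sym_bij adj_transp_def bij_transpose inv_adj_transp)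

lemma Sym_range: "w \<in> Sym n \<Longrightarrow> w a \<in> {1..n} \<longleftrightarrow> a \<in> {1..n}"
  by (simp only: Sym_def mem_Collect_eq permutes_in_image)

lemma Sym_fixes: "w \<in> Sym n \<Longrightarrow> a \<notin> {1..n} \<Longrightarrow> w a = a"
  by (metis Sym_def mem_Collect_eq permutes_not_in)

lemma finite_Sym: "finite (Sym n)"
  by (simp add: Sym_def finite_permutations)

lemma comp_adj_adj [simp]: "w \<circ> adj_transp i \<circ> adj_transp i = w"
  by (simp add: fun_eq_iff)

lemma adj_adj_comp [simp]: "adj_transp i \<circ> (adj_transp i \<circ> w) = w"
  by (simp add: fun_eq_iff)

lemma adj_transp_less_iff:
  assumes "a \<noteq> b" "{a, b} \<noteq> {i, i + 1}"
  shows "adj_transp i a < adj_transp i b \<longleftrightarrow> a < b"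
  using assms by (auto simp: adj_transp_apply)

definition inversion_set :: "nat \<Rightarrow> (nat \<Rightarrow> nat) \<Rightarrow> (nat \<times> nat) set" where
  "inversion_set n w = {(a, b). 1 \<le> a \<and> a < b \<and> b \<le> n \<and> w b < w a}"

definition inversions :: "nat \<Rightarrow> (nat \<Rightarrow> nat) \<Rightarrow> nat" where
  "inversions n w = card (inversion_set n w)"

lemma finite_inversion_set: "finite (inversion_set n w)"
  by (rule finite_subset[of _ "{1..n} \<times> {1..n}"]) (auto simp: inversion_set_def)

lemma inversions_id [simp]: "inversions n id = 0"
proof -
  have "inversion_set n id = {}"
    by (auto simp: inversion_set_def)
  then show ?thesis by (simp add: inversions_def)
qed

text \<open>Relabelling positions by \<open>adj_transp i\<close> carries the old inversions
  bijectively to all new ones except \<open>(i, i + 1)\<close>.\<close>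

lemma inversions_ascent:
  assumes "i \<in> {1..<n}" "w i < w (i + 1)"
  shows "inversions n (w \<circ> adj_transp i) = Suc (inversions n w)"
proof -
  let ?s = "adj_transp i"
  have "inversion_set n (w \<circ> ?s) = insert (i, i + 1) (map_prod ?s ?s ` inversion_set n w)" (is "?L = ?R")
  proof (intro equalityI subsetI)
    fix p assume p: "p \<in> ?L"
    obtain a b where ab: "p = (a, b)" by fastforce
    show "p \<in> ?R"
    proof (cases "p = (i, i + 1)")
      case False
      then have "(?s a, ?s b) \<in> inversion_set n w"
        using p assms by (auto simp: ab inversion_set_def adj_transp_apply split: if_splits)
      then have "map_prod ?s ?s (?s a, ?s b) \<in> map_prod ?s ?s ` inversion_set n w"
        by (rule imageI)
      then show ?thesis by (simp add: ab)
    qed simp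
  next
    fix p assume "p \<in> ?R"
    then consider "p = (i, i + 1)" | a b where "(a, b) \<in> inversion_set n w" "p = (?s a, ?s b)"
      by auto
    then show "p \<in> ?L"
    proof cases
      case 1
      then show ?thesis
        using assms by (simp add: inversion_set_def adj_transp_apply)
    next
      case 2
      then have ab: "1 \<le> a" "a < b" "b \<le> n" "w b < w a"
        by (simp_all add: inversion_set_def)
      then have "\<not> (a = i \<and> b = i + 1)"
        using assms(2) by auto
      then have "{a, b} \<noteq> {i, i + 1}"
        using ab(2) by (auto simp: doubleton_eq_iff)
      then have "?s a < ?s b"
        using ab(2) by (simp add: adj_transp_less_iff)
      moreover have "1 \<le> ?s a" "?s b \<le> n"
        using ab assms(1) by (simp_all add: adj_transp_apply)
      ultimately show ?thesis
        using 2(2) ab(4) by (simp add: inversion_set_def)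
    qed
  qed
  moreover have "(i, i + 1) \<notin> map_prod ?s ?s ` inversion_set n w"
  proof
    assume "(i, i + 1) \<in> map_prod ?s ?s ` inversion_set n w"
    then obtain a b where ab: "(a, b) \<in> inversion_set n w" "?s a = i" "?s b = i + 1"
      by force
    then have "a = ?s i" "b = ?s (i + 1)"
      by (metis adj_transp_involutory)+
    with ab(1) show False
      by (simp add: inversion_set_def adj_transp_apply)
  qed
  moreover have "inj (map_prod ?s ?s)"
    by (simp add: prod.inj_map)
  ultimately show ?thesis
    by (simp add: inversions_def finite_inversion_set card_image inj_on_subset[of _ UNIV])
qed

lemma inversions_descent:
  assumes "i \<in> {1..<n}" "w (i + 1) < w i"
  shows "inversions n w = Suc (inversions n (w \<circ> adj_transp i))"
  using inversions_ascent[of i n "w \<circ> adj_transp i"] assms by (simp add: adj_transp_apply)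

lemma inversions_inv:
  assumes "w \<in> Sym n"
  shows "inversions n (inv w) = inversions n w"
proof -
  have "inversion_set n (inv w) = (\<lambda>(a, b). (w b, w a)) ` inversion_set n w" (is "?L = ?R")
  proof (intro equalityI subsetI)
    fix p assume p: "p \<in> ?L"
    obtain a b where ab: "p = (a, b)" by fastforce
    have "(inv w b, inv w a) \<in> inversion_set n w"
      using p Sym_range[OF Sym_inv[OF assms]] assms
      by (fastforce simp: ab inversion_set_def Sym_inv_apply)
    then have "(\<lambda>(a, b). (w b, w a)) (inv w b, inv w a) \<in> ?R"
      by (rule imageI)
    then show "p \<in> ?R"
      using assms by (simp add: ab Sym_inv_apply)
  next
    fix p assume "p \<in> ?R"
    then show "p \<in> ?L"
      using Sym_range[OF assms] assms by (fastforce simp: inversion_set_def Sym_inv_apply)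
  qed
  moreover have "inj_on (\<lambda>(a, b). (w b, w a)) (inversion_set n w)"
    using assms by (auto intro!: inj_onI simp: Sym_inj)
  ultimately show ?thesis
    by (simp add: inversions_def card_image)
qed

lemma Sym_no_descent_imp_id:
  assumes w: "w \<in> Sym n" and asc: "\<And>i. i \<in> {1..<n} \<Longrightarrow> w i < w (i + 1)"
  shows "w = id"
proof -
  have ge: "i \<le> w i" if "1 \<le> i" "i \<le> n" for i
    using that
  proof (induction i rule: dec_induct)
    case base
    then show ?case using Sym_range[OF w, of 1] by simp
  next
    case (step i)
    then show ?case using asc[of i] by simp
  qed
  have le: "w i \<le> i" if "i \<le> n" "1 \<le> i" for i
    using that
  proof (induction i rule: inc_induct)
    case base
    then show ?case using Sym_range[OF w, of n] by simp
  next
    case (step i)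
    then show ?case using asc[of i] by simp
  qed
  show ?thesis
  proof
    fix i show "w i = id i"
      using ge[of i] le[of i] Sym_fixes[OF w, of i] by (cases "i \<in> {1..n}") auto
  qed
qed

text \<open>Induction along the right weak order; a permutation other than the identity has a
  descent, and undoing it removes one inversion.\<close>

lemma Sym_induct [consumes 1, case_names id ascent]:
  assumes "w \<in> Sym n" and "P id"
    and "\<And>w i. w \<in> Sym n \<Longrightarrow> i \<in> {1..<n} \<Longrightarrow> w i < w (i + 1) \<Longrightarrow> P w \<Longrightarrow> P (w \<circ> adj_transp i)"
  shows "P w"
  using assms(1)
proof (induction "inversions n w" arbitrary: w rule: less_induct)
  case less
  show ?case
  proof (cases "w = id")
    case False
    then obtain i where i: "i \<in> {1..<n}" "\<not> w i < w (i + 1)"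
      using Sym_no_descent_imp_id less.prems by blast
    then have desc: "w (i + 1) < w i"
      using Sym_inj[OF less.prems, of i "i + 1"] by simp
    have mem: "w \<circ> adj_transp i \<in> Sym n"
      by (intro Sym_comp less.prems Sym_adj_transp i)
    then have "P (w \<circ> adj_transp i)"
      using less.hyps inversions_descent[OF i(1) desc] by simp
    then have "P (w \<circ> adj_transp i \<circ> adj_transp i)"
      using assms(3)[OF mem i(1)] desc by (simp add: adj_transp_apply)
    then show ?thesis by simp
  qed (simp add: assms(2))
qed

lemma longest_perm_Sym: "longest_perm n \<in> Sym n"
proof -
  have "bij_betw (longest_perm n) {1..n} {1..n}"
    by (rule bij_betw_byWitness[where f' = "longest_perm n"]) (auto simp: longest_perm_def)
  then show ?thesis
    by (auto simp: Sym_def longest_perm_def intro!: bij_imp_permutes)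
qed

lemma Sym_no_ascent_imp_longest:
  assumes w: "w \<in> Sym n" and desc: "\<And>i. i \<in> {1..<n} \<Longrightarrow> w (i + 1) < w i"
  shows "w = longest_perm n"
proof -
  have "longest_perm n \<circ> w = id"
  proof (rule Sym_no_descent_imp_id)
    fix i assume i: "i \<in> {1..<n}"
    then have "w i \<in> {1..n}" "w (i + 1) \<in> {1..n}"
      using Sym_range[OF w] by auto
    then show "(longest_perm n \<circ> w) i < (longest_perm n \<circ> w) (i + 1)"
      using desc[OF i] by (auto simp: longest_perm_def)
  qed (intro Sym_comp longest_perm_Sym w)
  moreover have "longest_perm n \<circ> longest_perm n = id"
    by (auto simp: longest_perm_def fun_eq_iff)
  ultimately show ?thesis
    by (metis comp_assoc comp_id id_comp)
qed

text \<open>The bound is left as a sum because the summands are the lengths of the strings in the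
  staircase word.\<close>

lemma inversions_le: "inversions n w \<le> (\<Sum>i\<in>{1..n}. n - i)"
proof -
  have "inversion_set n w \<subseteq> Sigma {1..n} (\<lambda>a. {a<..n})"
    by (auto simp: inversion_set_def)
  then have "inversions n w \<le> card (Sigma {1..n} (\<lambda>a. {a<..n}))"
    unfolding inversions_def by (intro card_mono) auto
  then show ?thesis by simp
qed

lemma inversions_longest: "inversions n (longest_perm n) = (\<Sum>i\<in>{1..n}. n - i)"
proof -
  have "inversion_set n (longest_perm n) = Sigma {1..n} (\<lambda>a. {a<..n})"
    by (auto simp: inversion_set_def longest_perm_def)
  then show ?thesis by (simp add: inversions_def)
qed

section \<open>Reduced words and Coxeter length\<close>

lemma word_perm_Nil [simp]: "word_perm [] = id"
  by (simp add: word_perm_def)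

lemma word_perm_append [simp]: "word_perm (is @ js) = word_perm is \<circ> word_perm js"
  by (induction "is") (simp_all add: word_perm_def comp_assoc)

lemma word_perm_Cons [simp]: "word_perm (i # is) = adj_transp i \<circ> word_perm is"
  by (simp add: word_perm_def)

lemma word_perm_Sym: "set is \<subseteq> {1..<n} \<Longrightarrow> word_perm is \<in> Sym n"
  by (induction "is") (auto intro!: Sym_comp Sym_adj_transp)

lemma inversions_comp_adj_le: "i \<in> {1..<n} \<Longrightarrow> w \<in> Sym n \<Longrightarrow> inversions n (w \<circ> adj_transp i) \<le> Suc (inversions n w)"
  using inversions_ascent[of i n w] inversions_descent[of i n w] Sym_inj[of w n i "i + 1"]
  by (cases "w i < w (i + 1)") (auto simp: not_less order.order_iff_strict)

lemma inversions_word_le: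
  assumes "set is \<subseteq> {1..<n}" and "w \<in> Sym n"
  shows "inversions n (w \<circ> word_perm is) \<le> inversions n w + length is"
  using assms
proof (induction "is" arbitrary: w)
  case (Cons i "is")
  then have i: "i \<in> {1..<n}" by simp
  have "inversions n (w \<circ> adj_transp i \<circ> word_perm is) \<le> inversions n (w \<circ> adj_transp i) + length is"
    using Cons.prems by (intro Cons.IH Sym_comp Sym_adj_transp) auto
  also have "inversions n (w \<circ> adj_transp i) \<le> Suc (inversions n w)"
    by (rule inversions_comp_adj_le[OF i Cons.prems(2)])
  finally show ?case by (simp add: comp_assoc del: comp_apply)
qed simp

lemma reduced_word_exists:
  assumes "w \<in> Sym n"
  shows "\<exists>is. set is \<subseteq> {1..<n} \<and> word_perm is = w \<and> length is = inversions n w"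
  using assms
proof (induction rule: Sym_induct)
  case id
  then show ?case by (intro exI[of _ "[]"]) (simp del: id_apply)
next
  case (ascent w i)
  then obtain "is" where "set is \<subseteq> {1..<n}" "word_perm is = w" "length is = inversions n w"
    by blast
  then show ?case
    using ascent by (intro exI[of _ "is @ [i]"]) (simp add: inversions_ascent del: comp_apply)
qed

lemma cox_length_eq_inversions:
  assumes "w \<in> Sym n"
  shows "cox_length n w = inversions n w"
  unfolding cox_length_def
proof (rule Least_equality)
  show "\<exists>is. length is = inversions n w \<and> set is \<subseteq> {1..<n} \<and> word_perm is = w"
    using reduced_word_exists[OF assms] by blast
  fix k assume "\<exists>is. length is = k \<and> set is \<subseteq> {1..<n} \<and> word_perm is = w"
  then show "inversions n w \<le> k"
    using inversions_word_le[OF _ Sym_id] by (metis add_0 id_comp inversions_id)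
qed


section \<open>The Demazure product\<close>

text \<open>Multiplication by a generator of the 0-Hecke monoid: move up in length or stay.
  \<open>hecke_left\<close> reads ascents from the inverse, since left multiplication permutes
  values.\<close>

definition hecke_right :: "nat \<Rightarrow> (nat \<Rightarrow> nat) \<Rightarrow> nat \<Rightarrow> nat" where
  "hecke_right i w = (if w i < w (i + 1) then w \<circ> adj_transp i else w)"

definition hecke_left :: "nat \<Rightarrow> (nat \<Rightarrow> nat) \<Rightarrow> nat \<Rightarrow> nat" where
  "hecke_left i w = (if inv w i < inv w (i + 1) then adj_transp i \<circ> w else w)"

lemma hecke_right_Sym: "i \<in> {1..<n} \<Longrightarrow> w \<in> Sym n \<Longrightarrow> hecke_right i w \<in> Sym n"
  by (simp add: hecke_right_def Sym_comp Sym_adj_transp)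

lemma hecke_left_Sym: "i \<in> {1..<n} \<Longrightarrow> w \<in> Sym n \<Longrightarrow> hecke_left i w \<in> Sym n"
  by (simp add: hecke_left_def Sym_comp Sym_adj_transp)

lemma hecke_left_eq: "w \<in> Sym n \<Longrightarrow> hecke_left i w = inv (hecke_right i (inv w))"
  by (simp add: hecke_left_def hecke_right_def Sym_inv_comp_adj[OF Sym_inv] Sym_inv_inv)

text \<open>Let \<open>p\<close> and \<open>q\<close> be the positions of the values
  \<open>i\<close> and \<open>i + 1\<close>. If they are \<open>j\<close> and \<open>j + 1\<close>,
  the two operators have the same effect on \<open>w\<close>, and repeating it changes nothing.
  Otherwise neither operator alters the comparison that the other one makes.\<close>

lemma hecke_left_right_commute:
  assumes w: "w \<in> Sym n"
  shows "hecke_left i (hecke_right j w) = hecke_right j (hecke_left i w)"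
proof -
  define p q where "p = inv w i" and "q = inv w (i + 1)"
  have pq: "w p = i" "w q = i + 1"
    using w by (simp_all add: p_def q_def Sym_inv_apply)
  have p: "w a = i \<longleftrightarrow> a = p" and q: "w a = i + 1 \<longleftrightarrow> a = q" for a
    using Sym_inj[OF w, of a] pq by metis+
  have "p \<noteq> q" using pq by auto
  have inv: "inv (w \<circ> adj_transp j) = adj_transp j \<circ> inv w"
    by (rule Sym_inv_comp_adj[OF w])
  have left: "hecke_left i w = (if p < q then adj_transp i \<circ> w else w)"
    "hecke_left i (w \<circ> adj_transp j) =
      (if adj_transp j p < adj_transp j q then adj_transp i \<circ> w \<circ> adj_transp j else w \<circ> adj_transp j)"
    by (simp_all add: hecke_left_def inv p_def q_def comp_assoc)
  show ?thesis
  proof (cases "{p, q} = {j, j + 1}")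
    case True
    then consider "p = j" "q = j + 1" | "p = j + 1" "q = j"
      by (auto simp: doubleton_eq_iff)
    then show ?thesis
    proof cases
      case 1
      then have "adj_transp i (w a) = w (adj_transp j a)" for a
        using p[of a] q[of a] pq by (simp add: adj_transp_apply)
      then have "adj_transp i \<circ> w = w \<circ> adj_transp j"
        by (simp add: fun_eq_iff)
      then show ?thesis
        using 1 pq by (simp add: hecke_right_def left adj_transp_apply)
    next
      case 2
      then show ?thesis
        using pq by (simp add: hecke_right_def left adj_transp_apply)
    qed
  next
    case False
    then have "adj_transp j p < adj_transp j q \<longleftrightarrow> p < q"
      by (intro adj_transp_less_iff \<open>p \<noteq> q\<close>)
    moreover have "{w j, w (j + 1)} \<noteq> {i, i + 1}"
    proof
      assume "{w j, w (j + 1)} = {i, i + 1}"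
      then have "w ` {j, j + 1} = w ` {p, q}"
        by (simp add: pq)
      then show False
        using False inj_image_eq_iff[OF bij_is_inj[OF Sym_bij[OF w]]] by metis
    qed
    then have "adj_transp i (w j) < adj_transp i (w (j + 1)) \<longleftrightarrow> w j < w (j + 1)"
      using Sym_inj[OF w, of j "j + 1"] by (intro adj_transp_less_iff) simp_all
    ultimately show ?thesis
      by (simp add: hecke_right_def left)
  qed
qed

lemma fold_hecke_right_Sym: "set is \<subseteq> {1..<n} \<Longrightarrow> w \<in> Sym n \<Longrightarrow> fold hecke_right is w \<in> Sym n"
  by (induction "is" arbitrary: w) (simp_all add: hecke_right_Sym)

lemma fold_hecke_commute_single:
  "set is \<subseteq> {1..<n} \<Longrightarrow> w \<in> Sym n \<Longrightarrow>
    fold hecke_right is (hecke_left j w) = hecke_left j (fold hecke_right is w)"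
  by (induction "is" arbitrary: w) (simp_all add: hecke_right_Sym flip: hecke_left_right_commute[of _ n])

lemma fold_hecke_commute:
  "set is \<subseteq> {1..<n} \<Longrightarrow> set js \<subseteq> {1..<n} \<Longrightarrow> w \<in> Sym n \<Longrightarrow>
    fold hecke_right is (fold hecke_left js w) = fold hecke_left js (fold hecke_right is w)"
  by (induction js arbitrary: w) (simp_all add: hecke_left_Sym fold_hecke_commute_single)

text \<open>A word of this length can reach its end only if every letter is an ascent, so no
  operator stays put.\<close>

lemma fold_hecke_right_reduced:
  assumes "set is \<subseteq> {1..<n}" "v \<in> Sym n"
    and "inversions n (v \<circ> word_perm is) = inversions n v + length is"
  shows "fold hecke_right is v = v \<circ> word_perm is"
  using assms
proof (induction "is" arbitrary: v)
  case (Cons i "is")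
  then have i: "i \<in> {1..<n}" and "is": "set is \<subseteq> {1..<n}" by auto
  have mem: "v \<circ> adj_transp i \<in> Sym n"
    by (intro Sym_comp Cons Sym_adj_transp i)
  have le: "inversions n (v \<circ> adj_transp i \<circ> word_perm is) \<le> inversions n (v \<circ> adj_transp i) + length is"
    using "is" mem by (rule inversions_word_le)
  then have "inversions n v < inversions n (v \<circ> adj_transp i)"
    using Cons.prems(3) by (simp only: comp_assoc word_perm_Cons) simp
  then have asc: "v i < v (i + 1)"
    using inversions_descent[OF i, of v] Sym_inj[OF Cons.prems(2), of i "i + 1"]
    by (cases "v i < v (i + 1)") auto
  then have right: "hecke_right i v = v \<circ> adj_transp i"
    by (simp add: hecke_right_def)
  have "fold hecke_right is (v \<circ> adj_transp i) = v \<circ> adj_transp i \<circ> word_perm is"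
    using Cons.prems(3) inversions_ascent[OF i asc] "is" mem by (intro Cons.IH) (simp_all add: comp_assoc del: comp_apply)
  then show ?case
    by (simp only: fold_simps right comp_assoc word_perm_Cons)
qed simp

lemma fold_hecke_right_generates:
  assumes "w \<in> Sym n"
  shows "\<exists>is. set is \<subseteq> {1..<n} \<and> fold hecke_right is id = w"
proof -
  obtain "is" where "is": "set is \<subseteq> {1..<n}" "word_perm is = w" "length is = inversions n w"
    using reduced_word_exists[OF assms] by blast
  then have "fold hecke_right is id = w"
    using fold_hecke_right_reduced[of "is" n id] by simp
  with "is" show ?thesis by blast
qed

lemma fold_hecke_left_generates:
  assumes "w \<in> Sym n"
  shows "\<exists>is. set is \<subseteq> {1..<n} \<and> fold hecke_left is id = w"
proof -
  have single: "hecke_left i (inv v) = inv (hecke_right i v)" if "v \<in> Sym n" for i v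
    using hecke_left_eq[OF Sym_inv[OF that]] Sym_inv_inv[OF that] by simp
  have "fold hecke_left is (inv v) = inv (fold hecke_right is v)"
    if "set is \<subseteq> {1..<n}" "v \<in> Sym n" for "is" v
    using that
  proof (induction "is" arbitrary: v)
    case (Cons i "is")
    then show ?case
      using Cons.IH[of "hecke_right i v"] by (simp add: single hecke_right_Sym)
  qed simp
  from this[OF _ Sym_id] have *: "fold hecke_left is id = inv (fold hecke_right is id)"
    if "set is \<subseteq> {1..<n}" for "is"
    using that by simp
  obtain "is" where "is": "set is \<subseteq> {1..<n}" "fold hecke_right is id = inv w"
    using fold_hecke_right_generates[OF Sym_inv[OF assms]] by blast
  with * have "fold hecke_left is id = w"
    by (simp add: Sym_inv_inv[OF assms])
  with "is" show ?thesis by blast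
qed

text \<open>
  The operators \<open>hecke_right i\<close> commute with the operators \<open>hecke_left j\<close>, and the latter generate
  \<open>Sym n\<close> from the identity; so a composition of right operators is determined by its value at the
  identity.
\<close>

lemma fold_hecke_right_unique:
  assumes "set is \<subseteq> {1..<n}" "set js \<subseteq> {1..<n}" "w \<in> Sym n"
    and "fold hecke_right is id = fold hecke_right js id"
  shows "fold hecke_right is w = fold hecke_right js w"
proof -
  obtain ks where ks: "set ks \<subseteq> {1..<n}" "fold hecke_left ks id = w"
    using fold_hecke_left_generates[OF assms(3)] by blast
  show ?thesis
    using fold_hecke_commute[OF assms(1) ks(1) Sym_id] fold_hecke_commute[OF assms(2) ks(1) Sym_id] assms(4)
    by (simp add: ks(2))
qed

text \<open>Let a chosen word of the second argument act on the first; by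
  \<open>fold_hecke_right_unique\<close> the choice of the word does not matter. Associativity is
  concatenation of words, and length additivity makes a reduced word act by plain
  multiplication.\<close>

lemma demazure_product_exists: "\<exists>d. is_demazure_product n d"
proof -
  define word where "word v = (SOME is. set is \<subseteq> {1..<n} \<and> fold hecke_right is id = v)" for v
  have word: "set (word v) \<subseteq> {1..<n}" "fold hecke_right (word v) id = v" if "v \<in> Sym n" for v
    using someI_ex[OF fold_hecke_right_generates[OF that]] unfolding word_def by blast+
  define d where "d u v = fold hecke_right (word v) u" for u v
  have d_eq: "d u v = fold hecke_right is u"
    if "u \<in> Sym n" "v \<in> Sym n" "set is \<subseteq> {1..<n}" "fold hecke_right is id = v" for u v "is"
    unfolding d_def
    by (rule fold_hecke_right_unique[of _ n]) (use that word[OF that(2)] in simp_all)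
  have closed: "d u v \<in> Sym n" if "u \<in> Sym n" "v \<in> Sym n" for u v
    unfolding d_def by (rule fold_hecke_right_Sym[OF word(1)[OF that(2)] that(1)])
  have "d (d u v) w = d u (d v w)" if "u \<in> Sym n" "v \<in> Sym n" "w \<in> Sym n" for u v w
  proof -
    have "d u (d v w) = fold hecke_right (word v @ word w) u"
      by (rule d_eq) (use that word closed in \<open>simp_all add: d_def\<close>)
    then show ?thesis by (simp add: d_def)
  qed
  moreover have "d (adj_transp i) (adj_transp i) = adj_transp i" if "i \<in> {1..<n}" for i
  proof -
    have "d (adj_transp i) (adj_transp i) = fold hecke_right [i] (adj_transp i)"
      using that Sym_adj_transp[OF that] by (intro d_eq) (auto simp: hecke_right_def)
    then show ?thesis by (simp add: hecke_right_def adj_transp_apply)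
  qed
  moreover have "d v w = v \<circ> w"
    if v: "v \<in> Sym n" and w: "w \<in> Sym n" and len: "cox_length n (v \<circ> w) = cox_length n v + cox_length n w" for v w
  proof -
    obtain "is" where "is": "set is \<subseteq> {1..<n}" "word_perm is = w" "length is = inversions n w"
      using reduced_word_exists[OF w] by blast
    then have "fold hecke_right is id = w"
      using fold_hecke_right_reduced[of "is" n id] by simp
    then have "d v w = fold hecke_right is v"
      using v w "is" by (intro d_eq) auto
    also have "\<dots> = v \<circ> w"
      using fold_hecke_right_reduced[of "is" n v] "is" len v w
      by (simp add: cox_length_eq_inversions Sym_comp)
    finally show ?thesis .
  qed
  ultimately have "is_demazure_product n d"
    using closed by (simp add: is_demazure_product_def)
  then show ?thesis by blast
qed

lemma demazure_product: "is_demazure_product n (demazure n)"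
  unfolding demazure_def by (rule someI_ex[OF demazure_product_exists])

lemma demazure_Sym: "u \<in> Sym n \<Longrightarrow> v \<in> Sym n \<Longrightarrow> demazure n u v \<in> Sym n"
  using demazure_product unfolding is_demazure_product_def by blast

lemma demazure_assoc:
  "u \<in> Sym n \<Longrightarrow> v \<in> Sym n \<Longrightarrow> w \<in> Sym n \<Longrightarrow>
    demazure n (demazure n u v) w = demazure n u (demazure n v w)"
  using demazure_product unfolding is_demazure_product_def by blast

lemma demazure_reduced:
  "v \<in> Sym n \<Longrightarrow> w \<in> Sym n \<Longrightarrow> inversions n (v \<circ> w) = inversions n v + inversions n w \<Longrightarrow>
    demazure n v w = v \<circ> w"
  using demazure_product[of n] Sym_comp[of v n w] unfolding is_demazure_product_def
  by (simp add: cox_length_eq_inversions)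

lemma inversions_adj_transp: "i \<in> {1..<n} \<Longrightarrow> inversions n (adj_transp i) = 1"
  using inversions_ascent[of i n id] by simp

text \<open>Only the axioms are available for the chosen product. At a descent, split off the last
  letter by length additivity and absorb the second copy of it by idempotence.\<close>

lemma demazure_adj_right:
  assumes i: "i \<in> {1..<n}" and w: "w \<in> Sym n"
  shows "demazure n w (adj_transp i) = hecke_right i w"
proof -
  have asc: "demazure n v (adj_transp i) = v \<circ> adj_transp i" if "v \<in> Sym n" "v i < v (i + 1)" for v
    using that i by (intro demazure_reduced) (simp_all add: Sym_adj_transp inversions_ascent inversions_adj_transp)
  show ?thesis
  proof (cases "w i < w (i + 1)")
    case True
    then show ?thesis using asc w by (simp add: hecke_right_def)
  next
    case False
    define v where "v = w \<circ> adj_transp i"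
    have v: "v \<in> Sym n" "v i < v (i + 1)"
      using False w i Sym_inj[OF w, of i "i + 1"]
      by (auto simp: v_def Sym_comp Sym_adj_transp adj_transp_apply)
    have "demazure n (demazure n v (adj_transp i)) (adj_transp i) = demazure n v (adj_transp i)"
      using v i demazure_product[of n] by (simp add: demazure_assoc Sym_adj_transp is_demazure_product_def)
    moreover have "demazure n v (adj_transp i) = w"
      using asc[OF v] by (simp only: v_def comp_adj_adj)
    ultimately show ?thesis
      using False by (simp add: hecke_right_def)
  qed
qed

lemma demazure_adj_left:
  assumes i: "i \<in> {1..<n}" and w: "w \<in> Sym n"
  shows "demazure n (adj_transp i) w = hecke_left i w"
proof -
  have asc: "demazure n (adj_transp i) v = adj_transp i \<circ> v" if v: "v \<in> Sym n" "inv v i < inv v (i + 1)" for v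
  proof (rule demazure_reduced)
    have "inversions n (adj_transp i \<circ> v) = inversions n (inv v \<circ> adj_transp i)"
      using inversions_inv[of "adj_transp i \<circ> v" n] v i by (simp add: Sym_inv_adj_comp Sym_comp Sym_adj_transp)
    also have "\<dots> = inversions n (adj_transp i) + inversions n v"
      using inversions_ascent[of i n "inv v"] v i by (simp add: inversions_inv inversions_adj_transp)
    finally show "inversions n (adj_transp i \<circ> v) = inversions n (adj_transp i) + inversions n v" .
  qed (use v i in \<open>simp_all add: Sym_adj_transp\<close>)
  show ?thesis
  proof (cases "inv w i < inv w (i + 1)")
    case True
    then show ?thesis using asc w by (simp add: hecke_left_def)
  next
    case False
    define v where "v = adj_transp i \<circ> w"
    have v: "v \<in> Sym n" "inv v i < inv v (i + 1)"
      using False w i Sym_inj[OF Sym_inv[OF w], of i "i + 1"]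
      by (auto simp: v_def Sym_comp Sym_adj_transp Sym_inv_adj_comp adj_transp_apply)
    have "demazure n (adj_transp i) (demazure n (adj_transp i) v) = demazure n (adj_transp i) v"
      using v i demazure_product[of n]
      by (simp add: Sym_adj_transp is_demazure_product_def flip: demazure_assoc)
    moreover have "demazure n (adj_transp i) v = w"
      using asc[OF v] by (simp only: v_def adj_adj_comp)
    ultimately show ?thesis
      using False by (simp add: hecke_left_def)
  qed
qed

section \<open>Schubert polynomials as coefficients in the nil-Coxeter algebra\<close>

text \<open>Right multiplication by u_i read on coefficients: \<open>w\<close> receives something
  only if it ends in \<open>i\<close>, and then from the shorter
  \<open>w \<circ> adj_transp i\<close>.\<close>

definition nil_op :: "nat \<Rightarrow> nat \<Rightarrow> ((nat \<Rightarrow> nat) \<Rightarrow> 'r::comm_ring_1) \<Rightarrow> (nat \<Rightarrow> nat) \<Rightarrow> 'r" where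
  "nil_op n i f w = (if i \<in> {1..<n} \<and> w (i + 1) < w i then f (w \<circ> adj_transp i) else 0)"

lemma adj_transp_commute:
  "i + 1 < j \<Longrightarrow> adj_transp i \<circ> adj_transp j = adj_transp j \<circ> adj_transp i"
  by (auto simp: fun_eq_iff adj_transp_apply)

lemma adj_transp_braid:
  "adj_transp i \<circ> adj_transp (i + 1) \<circ> adj_transp i =
   adj_transp (i + 1) \<circ> adj_transp i \<circ> adj_transp (i + 1)"
  by (auto simp: fun_eq_iff adj_transp_apply)

text \<open>In the braid relation each side can be nonzero only where \<open>w\<close> decreases
  along \<open>i\<close>, \<open>i + 1\<close>, \<open>i + 2\<close>; there both evaluate
  \<open>f\<close> at the same permutation.\<close>

interpretation regular: nil_coxeter
  "nil_op n :: nat \<Rightarrow> ((nat \<Rightarrow> nat) \<Rightarrow> 'r::comm_ring_1) \<Rightarrow> (nat \<Rightarrow> nat) \<Rightarrow> 'r" n for n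
proof
  fix i :: nat and f g :: "(nat \<Rightarrow> nat) \<Rightarrow> 'r" and c
  show "nil_op n i (\<lambda>w. f w + c * g w) = (\<lambda>w. nil_op n i f w + c * nil_op n i g w)"
    by (simp add: nil_op_def fun_eq_iff)
next
  fix i :: nat and f :: "(nat \<Rightarrow> nat) \<Rightarrow> 'r"
  show "nil_op n i (nil_op n i f) = (\<lambda>w. 0)"
    by (simp add: nil_op_def fun_eq_iff adj_transp_apply)
next
  fix i j :: nat and f :: "(nat \<Rightarrow> nat) \<Rightarrow> 'r"
  assume ij: "i + 1 < j"
  show "nil_op n i (nil_op n j f) = nil_op n j (nil_op n i f)"
  proof
    fix w :: "nat \<Rightarrow> nat"
    have "w \<circ> adj_transp i \<circ> adj_transp j = w \<circ> adj_transp j \<circ> adj_transp i"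
      using adj_transp_commute[OF ij] by (simp only: comp_assoc)
    then show "nil_op n i (nil_op n j f) w = nil_op n j (nil_op n i f) w"
      using ij by (simp add: nil_op_def adj_transp_apply)
  qed
next
  fix i :: nat and f :: "(nat \<Rightarrow> nat) \<Rightarrow> 'r"
  show "nil_op n i (nil_op n (i + 1) (nil_op n i f)) =
      nil_op n (i + 1) (nil_op n i (nil_op n (i + 1) f))"
  proof
    fix w :: "nat \<Rightarrow> nat"
    have "w \<circ> adj_transp i \<circ> adj_transp (i + 1) \<circ> adj_transp i =
        w \<circ> adj_transp (i + 1) \<circ> adj_transp i \<circ> adj_transp (i + 1)"
      using adj_transp_braid[of i] by (simp only: comp_assoc)
    then show "nil_op n i (nil_op n (i + 1) (nil_op n i f)) w =
        nil_op n (i + 1) (nil_op n i (nil_op n (i + 1) f)) w"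
      by (simp add: nil_op_def adj_transp_apply)
  qed
next
  fix i :: nat and f :: "(nat \<Rightarrow> nat) \<Rightarrow> 'r"
  assume "n \<le> i"
  then show "nil_op n i f = (\<lambda>w. 0)"
    by (simp add: nil_op_def fun_eq_iff)
qed

definition delta :: "'b \<Rightarrow> 'b \<Rightarrow> 'r::comm_ring_1" where
  "delta a b = (if b = a then 1 else 0)"

lemma run_delta_short:
  assumes "fst ` set L \<subseteq> {1..<n}" "length L < inversions n w"
  shows "regular.run n L (delta id) w = 0"
  using assms
proof (induction L arbitrary: w rule: rev_induct)
  case Nil
  then have "w \<noteq> id"
    by (auto simp del: id_apply)
  then show ?case by (simp add: delta_def del: id_apply)
next
  case (snoc p L)
  obtain a x where p: "p = (a, x)" by fastforce
  have "regular.run n L (delta id) w = 0"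
    using snoc by (auto simp del: id_apply)
  moreover have "regular.run n L (delta id) (w \<circ> adj_transp a) = 0" if "w (a + 1) < w a"
    using snoc.prems inversions_descent[of a n w] that by (intro snoc.IH) (auto simp: p simp del: id_apply comp_apply)
  ultimately have "nil_op n a (regular.run n L (delta id)) w = 0" "regular.run n L (delta id) w = 0"
    by (simp_all add: nil_op_def del: id_apply)
  then have "regular.run n (L @ [p]) (delta id) w = 0"
    by (simp add: p regular.step_def)
  then show ?case .
qed

text \<open>Only one term of the expanded product is long enough: the one that takes the
  \<open>U\<close> part in every factor. By \<open>run_delta_short\<close> a word with the last
  letter omitted contributes nothing.\<close>

lemma run_delta_reduced:
  assumes "fst ` set L \<subseteq> {1..<n}" "length L = inversions n (word_perm (map fst L))"
  shows "regular.run n L (delta id) (word_perm (map fst L)) = prod_list (map snd L)"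
  using assms
proof (induction L rule: rev_induct)
  case Nil
  then show ?case by (simp add: delta_def)
next
  case (snoc p L)
  obtain a x where p: "p = (a, x)" by fastforce
  define v where "v = word_perm (map fst L)"
  have a: "a \<in> {1..<n}" and L: "fst ` set L \<subseteq> {1..<n}"
    using snoc.prems by (auto simp: p)
  have w: "word_perm (map fst (L @ [p])) = v \<circ> adj_transp a"
    by (simp add: p v_def)
  have len: "inversions n (v \<circ> adj_transp a) = Suc (length L)"
    using snoc.prems(2) unfolding w by (simp del: comp_apply)
  have v: "v \<in> Sym n"
    unfolding v_def using L by (intro word_perm_Sym) simp
  have le: "inversions n v \<le> length L"
    using inversions_word_le[of "map fst L" n id] L by (simp add: v_def)
  have asc: "v a < v (a + 1)"
  proof (rule ccontr)
    assume "\<not> v a < v (a + 1)"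
    then have "v (a + 1) < v a"
      using Sym_inj[OF v, of a "a + 1"] by simp
    then show False
      using inversions_descent[OF a, of v] le len by simp
  qed
  then have "length L = inversions n v"
    using inversions_ascent[OF a asc] len by simp
  then have "regular.run n L (delta id) v = prod_list (map snd L)"
    using snoc.IH L by (simp add: v_def del: id_apply)
  moreover have "regular.run n L (delta id) (v \<circ> adj_transp a) = 0"
    using L len by (intro run_delta_short) auto
  moreover have "nil_op n a f (v \<circ> adj_transp a) = f v" for f :: "_ \<Rightarrow> 'a"
    using a asc by (simp add: nil_op_def adj_transp_apply)
  ultimately have "regular.run n (L @ [p]) (delta id) (v \<circ> adj_transp a) = prod_list (map snd (L @ [p]))"
    by (simp add: p regular.step_def mult.commute)
  then show ?case
    unfolding w .
qed

section \<open>The staircase word and Schubert polynomials\<close>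

lemma word_perm_down:
  "i \<le> n \<Longrightarrow> word_perm (rev [i..<n]) k = (if k = i then n else if i < k \<and> k \<le> n then k - 1 else k)"
proof (induction i arbitrary: k rule: inc_induct)
  case base
  then show ?case by simp
next
  case (step i)
  then show ?case
    by (auto simp: upt_conv_Cons adj_transp_apply)
qed

text \<open>Each string sends the next position to the largest value still free and keeps the later
  positions in order, so after \<open>n\<close> strings the order is reversed.\<close>

lemma word_perm_stair:
  "k \<le> n \<Longrightarrow> word_perm (map fst (regular.stair n x k)) j =
    (if 1 \<le> j \<and> j \<le> k then n + 1 - j else if k < j \<and> j \<le> n then j - k else j)"
proof (induction k arbitrary: j)
  case 0
  then show ?case by (simp add: regular.stair_def)
next
  case (Suc k)
  have "map fst (regular.down n (Suc k) y) = rev [Suc k..<n]" for y :: 'a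
    by (simp add: regular.down_def rev_map comp_def)
  then have "word_perm (map fst (regular.stair n x (Suc k))) j =
      word_perm (map fst (regular.stair n x k)) (word_perm (rev [Suc k..<n]) j)"
    by (simp add: regular.stair_Suc)
  then show ?case
    using Suc by (auto simp: word_perm_down)
qed

lemma word_perm_stair_longest: "word_perm (map fst (regular.stair n x n)) = longest_perm n"
  by (auto simp: fun_eq_iff word_perm_stair longest_perm_def)

lemma length_stair: "length (regular.stair n x k) = (\<Sum>i\<in>{1..k}. n - i)"
  by (induction k) (simp_all add: regular.stair_Suc regular.down_def, simp add: regular.stair_def)

lemma prod_list_stair: "prod_list (map snd (regular.stair n x k)) = (\<Prod>i\<in>{1..k}. x i ^ (n - i))"
proof (induction k)
  case 0
  then show ?case by (simp add: regular.stair_def)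
next
  case (Suc k)
  have "map snd (regular.down n i y) = replicate (n - i) y" for i and y :: 'a
    by (simp add: regular.down_def rev_map comp_def map_replicate_const)
  then show ?case
    using Suc by (simp add: regular.stair_Suc)
qed

lemma fst_set_stair: "fst ` set (regular.stair n x k) \<subseteq> {1..<n}"
  by (auto simp: regular.stair_def regular.down_def)

definition stair_coeff :: "nat \<Rightarrow> (nat \<Rightarrow> nat) \<Rightarrow> int_mpoly" where
  "stair_coeff n = regular.run n (regular.stair n var n) (delta id)"

lemma stair_coeff_longest: "stair_coeff n (longest_perm n) = (\<Prod>i\<in>{1..<n}. var i ^ (n - i))"
proof -
  have "stair_coeff n (longest_perm n) = (\<Prod>i\<in>{1..n}. var i ^ (n - i))"
    using run_delta_reduced[OF fst_set_stair, of n var n]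
    by (simp add: stair_coeff_def word_perm_stair_longest length_stair inversions_longest prod_list_stair)
  \<comment> \<open>The factor at \<open>i = n\<close> has exponent 0.\<close>
  also have "\<dots> = (\<Prod>i\<in>{1..<n}. var i ^ (n - i))"
    by (rule prod.mono_neutral_right) auto
  finally show ?thesis .
qed

lemma stair_coeff_divided_difference:
  assumes "i \<in> {1..<n}"
  shows "(var i - var (i + 1)) * nil_op n i (stair_coeff n) w =
    stair_coeff n w - swap_vars i (stair_coeff n w)"
  unfolding stair_coeff_def
proof (rule regular.stair_divided_difference)
  show "nil_op n j (swap_vars i \<circ> f) = swap_vars i \<circ> nil_op n j f" for j f
    by (simp add: nil_op_def fun_eq_iff)
  show "swap_vars i \<circ> delta id = (delta id :: (nat \<Rightarrow> nat) \<Rightarrow> _)"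
    by (auto simp: delta_def fun_eq_iff)
qed (use assms in \<open>simp_all add: swap_vars_add swap_vars_mult swap_vars_var\<close>)

text \<open>\<open>stair_coeff\<close> makes no reference to a path from the longest element, so
  agreeing with it along every path gives path independence.\<close>

lemma is_schubert_unique: "is_schubert n w f \<Longrightarrow> w \<in> Sym n \<and> f = stair_coeff n w"
proof (induction rule: is_schubert.induct)
  case longest
  show ?case by (simp add: longest_perm_Sym stair_coeff_longest)
next
  case (descend w f i)
  have "divided_diff i f = nil_op n i (stair_coeff n) w"
    using descend stair_coeff_divided_difference by (intro divided_diff_eqI) auto
  then show ?case
    using descend by (simp add: nil_op_def Sym_comp Sym_adj_transp del: comp_apply)
qed

lemma is_schubert_exists: "w \<in> Sym n \<Longrightarrow> \<exists>f. is_schubert n w f"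
proof (induction "(\<Sum>i\<in>{1..n}. n - i) - inversions n w" arbitrary: w rule: less_induct)
  case less
  show ?case
  proof (cases "w = longest_perm n")
    case True
    then show ?thesis using is_schubert.longest by blast
  next
    case False
    then obtain i where i: "i \<in> {1..<n}" "\<not> w (i + 1) < w i"
      using Sym_no_ascent_imp_longest less.prems by blast
    then have asc: "w i < w (i + 1)"
      using Sym_inj[OF less.prems, of i "i + 1"] by simp
    have "w \<circ> adj_transp i \<in> Sym n"
      using i less.prems by (intro Sym_comp Sym_adj_transp)
    moreover have "inversions n w < inversions n (w \<circ> adj_transp i)"
      using inversions_ascent[of i n w] i asc by simp
    moreover have "inversions n (w \<circ> adj_transp i) \<le> (\<Sum>i\<in>{1..n}. n - i)"
      by (rule inversions_le)
    ultimately obtain f where "is_schubert n (w \<circ> adj_transp i) f"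
      using less.hyps[of "w \<circ> adj_transp i"] by (meson diff_less_mono2 less_le_trans)
    then have "is_schubert n (w \<circ> adj_transp i \<circ> adj_transp i) (divided_diff i f)"
      using i asc by (intro is_schubert.descend) (simp_all add: adj_transp_apply)
    then show ?thesis by (simp only: comp_adj_adj) blast
  qed
qed

lemma schubert_eq_stair_coeff:
  assumes "w \<in> Sym n"
  shows "schubert n w = stair_coeff n w"
  unfolding schubert_def
  using is_schubert_exists[OF assms] is_schubert_unique by (intro the_equality) blast+

section \<open>Nonnegative combinations\<close>

inductive_set nonneg_combinations :: "'a::comm_ring_1 set \<Rightarrow> 'a set" for G where
  zero: "0 \<in> nonneg_combinations G"
| plus: "f \<in> nonneg_combinations G \<Longrightarrow> p \<in> products G \<Longrightarrow> f + p \<in> nonneg_combinations G"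

lemma one_in_products: "1 \<in> products G"
  by (auto simp: products_def intro!: exI[of _ "{#}"])

lemma mult_in_products: "g \<in> G \<Longrightarrow> p \<in> products G \<Longrightarrow> g * p \<in> products G"
proof -
  assume g: "g \<in> G" and "p \<in> products G"
  then obtain M where "p = \<Prod>\<^sub># M" "set_mset M \<subseteq> G"
    by (auto simp: products_def)
  then show ?thesis
    using g by (auto simp: products_def intro!: exI[of _ "add_mset g M"])
qed

lemma nonneg_one: "1 \<in> nonneg_combinations G"
  using nonneg_combinations.plus[OF nonneg_combinations.zero one_in_products] by simp

lemma nonneg_add:
  "f \<in> nonneg_combinations G \<Longrightarrow> g \<in> nonneg_combinations G \<Longrightarrow> f + g \<in> nonneg_combinations G"
  by (rotate_tac 1, induction g rule: nonneg_combinations.induct)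
     (auto intro: nonneg_combinations.plus simp flip: add.assoc)

lemma nonneg_mult:
  "g \<in> G \<Longrightarrow> f \<in> nonneg_combinations G \<Longrightarrow> g * f \<in> nonneg_combinations G"
  by (rotate_tac 1, induction f rule: nonneg_combinations.induct)
     (auto intro: nonneg_combinations.intros mult_in_products simp: distrib_left)

lemma nonneg_power2_mult:
  "f \<in> nonneg_combinations G \<Longrightarrow> 2 ^ k * f \<in> nonneg_combinations G"
proof (induction k)
  case (Suc k)
  then show ?case
    using nonneg_add[of "2 ^ k * f" G "2 ^ k * f"] by (simp add: mult.assoc flip: mult_2)
qed simp

lemma positive_int_combination_product:
  "p \<in> P \<Longrightarrow> positive_int_combination P p"
  unfolding positive_int_combination_def by (intro exI[of _ "{p}"] exI[of _ "\<lambda>_. 1"]) simp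

lemma positive_int_combination_add:
  assumes "positive_int_combination P f" "p \<in> P"
  shows "positive_int_combination P (f + p)"
proof -
  obtain T c where T: "finite T" "T \<noteq> {}" "T \<subseteq> P" "\<forall>t\<in>T. (c t :: int) > 0"
    and f: "f = (\<Sum>t\<in>T. of_int (c t) * t)"
    using assms(1) by (auto simp: positive_int_combination_def)
  \<comment> \<open>The products form a set, so if \<open>p\<close> already occurs in
    \<open>T\<close> its coefficient has to grow.\<close>
  define d where "d t = (if t \<in> T then c t else 0) + (if t = p then 1 else 0)" for t
  have "(\<Sum>t\<in>insert p T. of_int (d t) * t) =
      (\<Sum>t\<in>insert p T. if t \<in> T then of_int (c t) * t else 0) + (\<Sum>t\<in>insert p T. if t = p then t else 0)"
    unfolding sum.distrib[symmetric] by (rule sum.cong) (auto simp: d_def distrib_right)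
  also have "(\<Sum>t\<in>insert p T. if t \<in> T then of_int (c t) * t else 0) = f"
    unfolding f using T(1) by (intro sum.mono_neutral_cong_right) auto
  also have "(\<Sum>t\<in>insert p T. if t = p then t else 0) = p"
    using T(1) by simp
  finally have "f + p = (\<Sum>t\<in>insert p T. of_int (d t) * t)" ..
  moreover have "\<forall>t\<in>insert p T. d t > 0"
    using T(4) by (auto simp: d_def add_pos_nonneg)
  ultimately show ?thesis
    unfolding positive_int_combination_def using T assms(2)
    by (intro exI[of _ "insert p T"] exI[of _ d]) auto
qed

lemma nonneg_nonzero_imp_positive:
  assumes "f \<in> nonneg_combinations G" "f \<noteq> 0"
  shows "positive_int_combination (products G) f"
  using assms
proof (induction rule: nonneg_combinations.induct)
  case (plus f p)
  then show ?case
    using positive_int_combination_product[of p] positive_int_combination_add[of _ f p]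
    by (cases "f = 0") auto
qed simp


section \<open>Sums of Schubert polynomials over sets of atoms\<close>

text \<open>
  In both applications \<open>atm y\<close> consists of those \<open>w\<close> which lead from \<open>base\<close> to \<open>y\<close> in the graph with edges
  \<open>\<sigma> i y \<rightarrow> y\<close> for the \<open>i\<close> with \<open>dsc i y\<close>.
\<close>

locale atom_graph =
  fixes n :: nat and Y :: "(nat \<Rightarrow> nat) set" and base :: "nat \<Rightarrow> nat"
    and dsc :: "nat \<Rightarrow> (nat \<Rightarrow> nat) \<Rightarrow> bool" and \<sigma> :: "nat \<Rightarrow> (nat \<Rightarrow> nat) \<Rightarrow> nat \<Rightarrow> nat"
    and atm :: "(nat \<Rightarrow> nat) \<Rightarrow> (nat \<Rightarrow> nat) set" and weight :: "(nat \<Rightarrow> nat) \<Rightarrow> nat"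
  assumes atm_Sym: "y \<in> Y \<Longrightarrow> atm y \<subseteq> Sym n"
    and base_Y: "base \<in> Y"
    and id_atm_iff: "y \<in> Y \<Longrightarrow> id \<in> atm y \<longleftrightarrow> y = base"
    and dsc_range: "dsc i y \<Longrightarrow> i \<in> {1..<n}"
    and not_dsc_base: "\<not> dsc i base"
    and dsc_exists: "y \<in> Y \<Longrightarrow> y \<noteq> base \<Longrightarrow> \<exists>i. dsc i y"
    and \<sigma>_Y: "y \<in> Y \<Longrightarrow> dsc i y \<Longrightarrow> \<sigma> i y \<in> Y"
    and \<sigma>_inversions: "y \<in> Y \<Longrightarrow> dsc i y \<Longrightarrow> inversions n (\<sigma> i y) < inversions n y"
    and \<sigma>_weight: "y \<in> Y \<Longrightarrow> dsc i y \<Longrightarrow> weight (\<sigma> i y) \<le> weight y"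
    and atm_down: "y \<in> Y \<Longrightarrow> w \<in> atm y \<Longrightarrow> i \<in> {1..<n} \<Longrightarrow> w (i + 1) < w i \<Longrightarrow>
      dsc i y \<and> w \<circ> adj_transp i \<in> atm (\<sigma> i y)"
    and atm_up: "y \<in> Y \<Longrightarrow> dsc i y \<Longrightarrow> v \<in> atm (\<sigma> i y) \<Longrightarrow>
      v i < v (i + 1) \<and> v \<circ> adj_transp i \<in> atm y"
begin

definition atom_op :: "nat \<Rightarrow> ((nat \<Rightarrow> nat) \<Rightarrow> 'r::comm_ring_1) \<Rightarrow> (nat \<Rightarrow> nat) \<Rightarrow> 'r" where
  "atom_op i f y = (if y \<in> Y \<and> dsc i y then f (\<sigma> i y) else 0)"

text \<open>The module map sending \<open>id\<close> to \<open>base\<close>, on coefficients: each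
  \<open>w\<close> contributes to the \<open>y\<close> of which it is an atom. The value 0 off
  \<open>Y\<close> lets \<open>proj_nil_op\<close> be an equation of functions.\<close>

definition proj :: "((nat \<Rightarrow> nat) \<Rightarrow> 'r::comm_ring_1) \<Rightarrow> (nat \<Rightarrow> nat) \<Rightarrow> 'r" where
  "proj f y = (if y \<in> Y then \<Sum>w\<in>atm y. f w else 0)"

sublocale atomic: linear_ops "atom_op :: nat \<Rightarrow> ((nat \<Rightarrow> nat) \<Rightarrow> 'r::comm_ring_1) \<Rightarrow> (nat \<Rightarrow> nat) \<Rightarrow> 'r"
  by standard (simp add: atom_op_def fun_eq_iff)

lemma finite_atm: "y \<in> Y \<Longrightarrow> finite (atm y)"
  using atm_Sym finite_Sym finite_subset by blast

lemma proj_lin: "proj (\<lambda>w. f w + c * g w) = (\<lambda>y. proj f y + c * proj g y)"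
  by (simp add: proj_def fun_eq_iff sum.distrib sum_distrib_left)

text \<open>Removing the last letter \<open>i\<close> is a bijection from the atoms of
  \<open>y\<close> with a descent at \<open>i\<close> to the atoms of \<open>\<sigma> i y\<close>;
  without an edge there are no such atoms.\<close>

lemma proj_nil_op: "proj (nil_op n i f) = atom_op i (proj f)"
proof
  fix y
  consider "y \<notin> Y" | "y \<in> Y" "\<not> dsc i y" | "y \<in> Y" "dsc i y" by blast
  then show "proj (nil_op n i f) y = atom_op i (proj f) y"
  proof cases
    case 1
    then show ?thesis by (simp add: proj_def atom_op_def)
  next
    case 2
    then have "nil_op n i f w = 0" if "w \<in> atm y" for w
      using atm_down[OF 2(1) that, of i] by (auto simp: nil_op_def)
    then show ?thesis
      using 2 by (simp add: proj_def atom_op_def)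
  next
    case 3
    have i: "i \<in> {1..<n}" using 3 dsc_range by blast
    have "(\<Sum>w\<in>atm y. nil_op n i f w) = (\<Sum>w\<in>{w \<in> atm y. w (i + 1) < w i}. f (w \<circ> adj_transp i))"
      using i finite_atm[OF 3(1)] by (simp add: nil_op_def sum.inter_filter)
    also have "\<dots> = (\<Sum>v\<in>atm (\<sigma> i y). f v)"
      by (rule sum.reindex_bij_witness[of _ "\<lambda>v. v \<circ> adj_transp i" "\<lambda>w. w \<circ> adj_transp i"])
        (use atm_down[OF 3(1) _ i] atm_up[OF 3] in
          \<open>auto simp: adj_transp_apply comp_apply[of _ _ i] comp_apply[of _ _ "Suc i"] simp del: comp_apply\<close>)
    finally show ?thesis
      using 3 \<sigma>_Y by (simp add: proj_def atom_op_def)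
  qed
qed

lemma proj_run: "proj (regular.run n L f) = atomic.run L (proj f)"
proof (induction L arbitrary: f)
  case (Cons p L)
  obtain i x where p: "p = (i, x)" by fastforce
  have "proj (regular.step n i x f) = atomic.step i x (proj f)"
    by (simp only: regular.step_def atomic.step_def proj_lin proj_nil_op)
  then show ?case
    by (simp only: p regular.run_simps atomic.run_simps Cons)
qed simp

lemma proj_delta: "proj (delta v) y = (if y \<in> Y \<and> v \<in> atm y then 1 else 0)"
  using finite_atm[of y] by (simp add: proj_def delta_def)

lemma proj_delta_id: "proj (delta id) = delta base"
proof
  fix y
  show "proj (delta id) y = (delta base y :: 'a)"
    using id_atm_iff[of y] base_Y by (auto simp: proj_delta delta_def simp del: id_apply)
qed

definition atom_schubert :: "(nat \<Rightarrow> nat) \<Rightarrow> int_mpoly" where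
  "atom_schubert = proj (stair_coeff n)"

lemma atom_schubert_eq: "y \<in> Y \<Longrightarrow> atom_schubert y = (\<Sum>w\<in>atm y. schubert n w)"
  using atm_Sym[of y] unfolding atom_schubert_def proj_def
  by (auto simp: schubert_eq_stair_coeff intro!: sum.cong)

lemma atom_schubert_divided_difference:
  assumes "y \<in> Y" "dsc i y"
  shows "(var i - var (i + 1)) * atom_schubert (\<sigma> i y) =
    atom_schubert y - swap_vars i (atom_schubert y)"
proof -
  have "(var i - var (i + 1)) * atom_op i atom_schubert y =
      (var i - var (i + 1)) * proj (nil_op n i (stair_coeff n)) y"
    by (simp only: atom_schubert_def proj_nil_op)
  also have "\<dots> = (\<Sum>w\<in>atm y. stair_coeff n w - swap_vars i (stair_coeff n w))"
    using assms stair_coeff_divided_difference[OF dsc_range[OF assms(2)]]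
    by (simp add: proj_def sum_distrib_left)
  finally show ?thesis
    using assms by (simp add: atom_op_def atom_schubert_def proj_def sum_subtractf swap_vars_sum)
qed

lemma step_base: "atomic.step i x f base = f base"
  by (simp add: atomic.step_def atom_op_def not_dsc_base)

lemma run_base: "atomic.run L f base = f base"
proof (induction L arbitrary: f)
  case (Cons p L)
  then show ?case
    by (cases p) (simp add: step_base)
qed simp

text \<open>If the polynomial of \<open>y\<close> vanished, its divided difference, the polynomial
  of a smaller element, would vanish too. At \<open>base\<close> no edge arrives, so the coefficient
  stays 1.\<close>

lemma atom_schubert_nonzero: "y \<in> Y \<Longrightarrow> atom_schubert y \<noteq> 0"
proof (induction "inversions n y" arbitrary: y rule: less_induct)
  case less
  show ?case
  proof (cases "y = base")
    case True
    then show ?thesis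
      by (simp add: atom_schubert_def stair_coeff_def proj_run proj_delta_id run_base delta_def)
  next
    case False
    then obtain i where i: "dsc i y"
      using dsc_exists less.prems by blast
    then have "(var i - var (i + 1)) * atom_schubert (\<sigma> i y) \<noteq> 0"
      using less \<sigma>_inversions \<sigma>_Y by simp
    then show ?thesis
      using atom_schubert_divided_difference[OF less.prems i] by auto
  qed
qed

definition good :: "int_mpoly set \<Rightarrow> ((nat \<Rightarrow> nat) \<Rightarrow> int_mpoly) \<Rightarrow> bool" where
  "good G f \<longleftrightarrow> (\<forall>y\<in>Y. 2 ^ weight y * f y \<in> nonneg_combinations G)"

lemma good_run:
  assumes "snd ` set L \<subseteq> G" "good G f"
  shows "good G (atomic.run L f)"
  using assms
proof (induction L arbitrary: f)
  case (Cons p L)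
  obtain i x where p: "p = (i, x)" by fastforce
  have "good G (atomic.step i x f)"
    unfolding good_def
  proof
    fix y assume y: "y \<in> Y"
    have "2 ^ weight y * (x * atom_op i f y) \<in> nonneg_combinations G"
    proof (cases "dsc i y")
      case True
      \<comment> \<open>The weight never decreases along an edge. The surplus power of 2 is a
        natural number and preserves nonnegativity.\<close>
      then obtain k where "weight y = k + weight (\<sigma> i y)"
        using \<sigma>_weight[OF y] le_Suc_ex by (metis add.commute)
      then have "2 ^ weight y * (x * atom_op i f y) = x * (2 ^ k * (2 ^ weight (\<sigma> i y) * f (\<sigma> i y)))"
        using y True by (simp add: atom_op_def power_add mult_ac)
      moreover have "2 ^ weight (\<sigma> i y) * f (\<sigma> i y) \<in> nonneg_combinations G"
        using Cons.prems(2) \<sigma>_Y[OF y True] by (simp add: good_def)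
      then have "x * (2 ^ k * (2 ^ weight (\<sigma> i y) * f (\<sigma> i y))) \<in> nonneg_combinations G"
        using Cons.prems(1) by (intro nonneg_mult[of x] nonneg_power2_mult[of "_ * _"]) (simp_all add: p)
      ultimately show ?thesis
        by (simp only:)
    qed (simp add: atom_op_def nonneg_combinations.zero)
    then show "2 ^ weight y * atomic.step i x f y \<in> nonneg_combinations G"
      using Cons.prems(2) y by (auto simp: atomic.step_def good_def distrib_left intro: nonneg_add)
  qed
  then show ?case
    using Cons by (simp add: p)
qed simp

text \<open>\<open>v k\<close> stands for the vector together with the factors left unpaired after
  \<open>k\<close> strings; the paired factors preserve \<open>good\<close>, so only
  \<open>v n\<close> needs inspection.\<close>

lemma positive_atom_schubert:
  fixes v :: "nat \<Rightarrow> (nat \<Rightarrow> nat) \<Rightarrow> int_mpoly"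
  assumes v: "v 0 = delta id" "good G (proj (v n))"
    and G: "\<And>i j. 1 \<le> i \<Longrightarrow> i < j \<Longrightarrow> j \<le> n \<Longrightarrow> var i + var j \<in> G"
    and turn: "\<And>k. proj (regular.run n (regular.down n (2 * k + 1) (var (k + 1))) (v k)) =
                    proj (regular.run n (regular.up n (2 * k + 2) (var (k + 1))) (v (k + 1)))"
    and y: "y \<in> Y"
  shows "positive_int_combination (products G) (2 ^ weight y * atom_schubert y)"
proof (rule nonneg_nonzero_imp_positive)
  have cong: "proj (regular.run n L f) = proj (regular.run n L g)" if "proj f = proj g"
    for L and f g :: "(nat \<Rightarrow> nat) \<Rightarrow> int_mpoly"
    using that by (simp add: proj_run)
  have "atom_schubert = proj (regular.run n (regular.stair n var n) (v 0))"
    by (simp add: atom_schubert_def stair_coeff_def v(1))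
  also have "\<dots> = proj (regular.run n (regular.blocks n var n n) (v n))"
    using regular.stair_fold[of proj n var v n, OF cong turn] .
  finally have "atom_schubert = atomic.run (regular.blocks n var n n) (proj (v n))"
    by (simp add: proj_run)
  \<comment> \<open>At stage \<open>n\<close> the tails would begin at \<open>j + n\<close> and are
    empty, leaving only sums of two different variables.\<close>
  moreover have "snd ` set (regular.blocks n var n n) \<subseteq> G"
    by (auto simp: regular.blocks_def regular.block_def regular.up_empty intro!: G)
  ultimately have "good G atom_schubert"
    using v(2) by (simp add: good_run)
  then show "2 ^ weight y * atom_schubert y \<in> nonneg_combinations G"
    using y by (simp add: good_def)
  show "2 ^ weight y * atom_schubert y \<noteq> 0"
    using atom_schubert_nonzero[OF y] by simp
qed

end

section \<open>Atoms of involutions\<close>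

definition conj_adj :: "nat \<Rightarrow> (nat \<Rightarrow> nat) \<Rightarrow> nat \<Rightarrow> nat" where
  "conj_adj i y = adj_transp i \<circ> y \<circ> adj_transp i"

text \<open>The Richardson-Springer move on involutions, in a form that is its own inverse: it goes
  up at an ascent and down at a descent.\<close>

definition flip :: "nat \<Rightarrow> (nat \<Rightarrow> nat) \<Rightarrow> nat \<Rightarrow> nat" where
  "flip i y = (if conj_adj i y = y then y \<circ> adj_transp i else conj_adj i y)"

lemma conj_adj_apply: "conj_adj i y a = adj_transp i (y (adj_transp i a))"
  by (simp add: conj_adj_def)

lemma conj_adj_conj_adj [simp]: "conj_adj i (conj_adj i y) = y"
  by (simp add: fun_eq_iff conj_adj_apply)

lemma involutions_Sym: "y \<in> involutions n \<Longrightarrow> y \<in> Sym n"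
  by (simp add: involutions_def)

lemma involutions_inv: "y \<in> involutions n \<Longrightarrow> inv y = y"
  by (simp add: involutions_def)

lemma involutions_apply: "y \<in> involutions n \<Longrightarrow> y (y a) = a"
  by (metis Sym_inv_apply(1) involutions_Sym involutions_inv)

lemma involutionsI: "y \<in> Sym n \<Longrightarrow> (\<And>a. y (y a) = a) \<Longrightarrow> y \<in> involutions n"
  using inv_unique_comp[of y y] by (simp add: involutions_def fun_eq_iff)

lemma conj_adj_involutions: "i \<in> {1..<n} \<Longrightarrow> y \<in> involutions n \<Longrightarrow> conj_adj i y \<in> involutions n"
  by (rule involutionsI)
     (simp_all add: conj_adj_apply involutions_apply, simp add: conj_adj_def involutions_Sym Sym_comp Sym_adj_transp)

lemma conj_adj_eq_iff:
  assumes "y \<in> Sym n"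
  shows "conj_adj i y = y \<longleftrightarrow> {y i, y (i + 1)} = {i, i + 1}"
proof
  assume "conj_adj i y = y"
  then have "y i = adj_transp i (y (i + 1))"
    by (metis conj_adj_apply adj_transp_apply)
  then show "{y i, y (i + 1)} = {i, i + 1}"
    using Sym_inj[OF assms, of i "i + 1"] by (auto simp: adj_transp_apply split: if_splits)
next
  assume eq: "{y i, y (i + 1)} = {i, i + 1}"
  have "conj_adj i y a = y a" for a
  proof (cases "a \<in> {i, i + 1}")
    case True
    then show ?thesis
      using eq by (auto simp: conj_adj_apply adj_transp_apply doubleton_eq_iff)
  next
    case False
    then have "y a \<notin> {y i, y (i + 1)}"
      using Sym_inj[OF assms] by auto
    then show ?thesis
      using False unfolding eq by (simp add: conj_adj_apply adj_transp_apply)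
  qed
  then show "conj_adj i y = y" ..
qed

lemma conj_adj_less_iff:
  assumes "y \<in> Sym n" "conj_adj i y \<noteq> y"
  shows "conj_adj i y i < conj_adj i y (i + 1) \<longleftrightarrow> y (i + 1) < y i"
proof -
  have "conj_adj i y i < conj_adj i y (i + 1) \<longleftrightarrow> adj_transp i (y (i + 1)) < adj_transp i (y i)"
    by (simp add: conj_adj_apply adj_transp_apply)
  also have "\<dots> \<longleftrightarrow> y (i + 1) < y i"
    using assms Sym_inj[OF assms(1), of i "i + 1"] conj_adj_eq_iff[OF assms(1), of i]
    by (intro adj_transp_less_iff) (auto simp: insert_commute)
  finally show ?thesis .
qed

text \<open>Each of the two multiplications adds one inversion. The ascent survives the first one
  because the values at \<open>i\<close> and \<open>i + 1\<close> are not \<open>i\<close> and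
  \<open>i + 1\<close> themselves.\<close>

lemma inversions_conj_adj:
  assumes y: "y \<in> involutions n" and i: "i \<in> {1..<n}" "y i < y (i + 1)" and ne: "conj_adj i y \<noteq> y"
  shows "inversions n (conj_adj i y) = inversions n y + 2"
proof -
  define z where "z = adj_transp i \<circ> y"
  have ySym: "y \<in> Sym n" by (rule involutions_Sym[OF y])
  have "inv (y \<circ> adj_transp i) = z"
    by (simp add: z_def Sym_inv_comp_adj[OF ySym] involutions_inv[OF y])
  then have "inversions n z = inversions n (y \<circ> adj_transp i)"
    using inversions_inv[of "y \<circ> adj_transp i" n] Sym_comp[OF ySym Sym_adj_transp[OF i(1)]] by simp
  also have "\<dots> = Suc (inversions n y)"
    by (rule inversions_ascent[OF i])
  finally have "inversions n z = Suc (inversions n y)" .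
  moreover have "z i < z (i + 1)"
    using adj_transp_less_iff[of "y i" "y (i + 1)" i] conj_adj_eq_iff[OF ySym, of i] i(2) ne
    by (simp add: z_def)
  then have "inversions n (z \<circ> adj_transp i) = Suc (inversions n z)"
    by (rule inversions_ascent[OF i(1)])
  ultimately show ?thesis
    by (simp add: z_def conj_adj_def)
qed

text \<open>Moved points behave simply under \<open>flip\<close>: conjugation permutes them, and a
  commuting ascent adds exactly two.\<close>

lemma num_two_cycles_eq:
  assumes y: "y \<in> involutions n"
  shows "2 * num_two_cycles n y = card {a. y a \<noteq> a}"
proof -
  have Sym: "y \<in> Sym n" by (rule involutions_Sym[OF y])
  have range: "a \<in> {1..n} \<and> y a \<in> {1..n}" if "y a \<noteq> a" for a
    using that Sym_fixes[OF Sym, of a] Sym_range[OF Sym, of a] by blast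
  have fin: "finite {a. y a \<noteq> a}"
    by (rule finite_subset[of _ "{1..n}"]) (use range in auto)
  have "{(i, j). 1 \<le> i \<and> i < j \<and> j \<le> n \<and> y i = j \<and> y j = i} = (\<lambda>i. (i, y i)) ` {i. i < y i}"
    using range involutions_apply[OF y] by (fastforce simp: image_iff)
  then have "num_two_cycles n y = card {i. i < y i}"
    unfolding num_two_cycles_def by (simp add: card_image inj_on_def)
  moreover have "{i. y i < i} = y ` {i. i < y i}"
  proof (intro equalityI subsetI)
    fix a assume "a \<in> {i. y i < i}"
    then have "y a \<in> {i. i < y i}"
      by (simp add: involutions_apply[OF y])
    then have "y (y a) \<in> y ` {i. i < y i}"
      by (rule imageI)
    then show "a \<in> y ` {i. i < y i}"
      by (simp only: involutions_apply[OF y])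
  qed (auto simp: involutions_apply[OF y])
  then have "card {i. y i < i} = card {i. i < y i}"
    by (simp add: card_image inj_on_def Sym_inj[OF Sym])
  moreover have "card {a. y a \<noteq> a} = card {i. i < y i} + card {i. y i < i}"
  proof -
    have "{a. y a \<noteq> a} = {i. i < y i} \<union> {i. y i < i}" by auto
    then show ?thesis
      using fin by (simp only: card_Un_disjoint finite_Un) (auto intro!: card_Un_disjoint)
  qed
  ultimately show ?thesis by simp
qed

lemma num_two_cycles_conj_adj:
  assumes "y \<in> involutions n" "i \<in> {1..<n}"
  shows "num_two_cycles n (conj_adj i y) = num_two_cycles n y"
proof -
  have "{a. conj_adj i y a \<noteq> a} = adj_transp i ` {a. y a \<noteq> a}"
  proof (intro equalityI subsetI)
    fix a assume "a \<in> {a. conj_adj i y a \<noteq> a}"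
    then have "y (adj_transp i a) \<noteq> adj_transp i a"
      by (auto simp: conj_adj_apply)
    then have "adj_transp i (adj_transp i a) \<in> adj_transp i ` {a. y a \<noteq> a}"
      by (intro imageI) simp
    then show "a \<in> adj_transp i ` {a. y a \<noteq> a}" by simp
  next
    fix a assume "a \<in> adj_transp i ` {a. y a \<noteq> a}"
    then obtain b where "a = adj_transp i b" "y b \<noteq> b" by auto
    then show "a \<in> {a. conj_adj i y a \<noteq> a}"
      using inj_eq[OF inj_adj_transp] by (simp add: conj_adj_apply)
  qed
  then have "card {a. conj_adj i y a \<noteq> a} = card {a. y a \<noteq> a}"
    by (simp add: card_image inj_on_subset[OF inj_adj_transp])
  then show ?thesis
    using num_two_cycles_eq[OF assms(1)] num_two_cycles_eq[OF conj_adj_involutions[OF assms(2,1)]] by simp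
qed

lemma commuting_ascent:
  assumes "y \<in> Sym n" "conj_adj i y = y" "y i < y (i + 1)"
  shows "y i = i" "y (i + 1) = i + 1"
  using assms conj_adj_eq_iff[OF assms(1), of i] by (auto simp: doubleton_eq_iff)

lemma commuting_flip_involutions:
  assumes y: "y \<in> involutions n" and i: "i \<in> {1..<n}" and c: "conj_adj i y = y"
  shows "y \<circ> adj_transp i \<in> involutions n"
proof (rule involutionsI)
  fix a
  have "adj_transp i (y (adj_transp i a)) = y a"
    using c by (metis conj_adj_apply)
  then have "y (adj_transp i (y (adj_transp i a))) = a"
    by (simp add: involutions_apply[OF y])
  then show "(y \<circ> adj_transp i) ((y \<circ> adj_transp i) a) = a" by simp
qed (intro Sym_comp involutions_Sym[OF y] Sym_adj_transp[OF i])

lemma num_two_cycles_commuting: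
  assumes y: "y \<in> involutions n" and i: "i \<in> {1..<n}" "y i < y (i + 1)" and c: "conj_adj i y = y"
  shows "num_two_cycles n (y \<circ> adj_transp i) = Suc (num_two_cycles n y)"
proof -
  have Sym: "y \<in> Sym n" by (rule involutions_Sym[OF y])
  have fix_i: "y i = i" "y (i + 1) = i + 1"
    using commuting_ascent[OF Sym c i(2)] by simp_all
  have "{a. y a \<noteq> a} \<subseteq> {1..n}"
    using Sym_fixes[OF Sym] by blast
  then have "finite {a. y a \<noteq> a}"
    by (rule finite_subset) simp
  moreover have "{a. (y \<circ> adj_transp i) a \<noteq> a} = insert i (insert (i + 1) {a. y a \<noteq> a})"
    using fix_i by (auto simp: adj_transp_apply)
  ultimately have "card {a. (y \<circ> adj_transp i) a \<noteq> a} = card {a. y a \<noteq> a} + 2"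
    using fix_i by simp
  then show ?thesis
    using num_two_cycles_eq[OF y] num_two_cycles_eq[OF commuting_flip_involutions[OF y i(1) c]] by simp
qed

lemma flip_involutions: "i \<in> {1..<n} \<Longrightarrow> y \<in> involutions n \<Longrightarrow> flip i y \<in> involutions n"
  by (simp add: flip_def conj_adj_involutions commuting_flip_involutions)

lemma flip_flip:
  assumes "y \<in> involutions n"
  shows "flip i (flip i y) = y"
proof (cases "conj_adj i y = y")
  case True
  then have "conj_adj i (y \<circ> adj_transp i) = y \<circ> adj_transp i"
    by (metis adj_adj_comp comp_adj_adj comp_assoc conj_adj_def)
  then show ?thesis
    using True by (simp add: flip_def)
next
  case False
  then show ?thesis
    by (auto simp: flip_def)
qed

lemma flip_less_iff:
  assumes "y \<in> involutions n"
  shows "flip i y i < flip i y (i + 1) \<longleftrightarrow> y (i + 1) < y i"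
  using conj_adj_less_iff[OF involutions_Sym[OF assms], of i]
  by (simp add: flip_def adj_transp_apply)

text \<open>Conjugation adds two inversions and no cycle, a commuting move one inversion and one
  cycle. The sum therefore always grows by 2, and half of it is the rank of an involution.\<close>

lemma flip_ascent:
  assumes "y \<in> involutions n" "i \<in> {1..<n}" "y i < y (i + 1)"
  shows "inversions n (flip i y) + num_two_cycles n (flip i y) = inversions n y + num_two_cycles n y + 2"
    and "inversions n y < inversions n (flip i y)"
    and "num_two_cycles n y \<le> num_two_cycles n (flip i y)"
  using assms inversions_conj_adj[OF assms] num_two_cycles_conj_adj[OF assms(1,2)]
    num_two_cycles_commuting[OF assms] inversions_ascent[OF assms(2,3)]
  by (auto simp: flip_def)

lemma not_ascent_iff: "y \<in> Sym n \<Longrightarrow> \<not> y i < y (i + 1) \<longleftrightarrow> y (i + 1) < y i"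
  using Sym_inj[of y n i "i + 1"] by auto

section \<open>Involutions as Demazure products and the length of their atoms\<close>

definition involution_of :: "nat \<Rightarrow> (nat \<Rightarrow> nat) \<Rightarrow> nat \<Rightarrow> nat" where
  "involution_of n w = demazure n (inv w) w"

lemma involution_of_id: "involution_of n id = id"
  unfolding involution_of_def using demazure_reduced[of id n id] by simp

text \<open>After a right multiplication at an ascent, the left one acts exactly when
  \<open>adj_transp i\<close> does not commute with \<open>y\<close>, which is the case distinction
  in \<open>flip\<close>.\<close>

lemma hecke_conj:
  assumes "y \<in> involutions n"
  shows "hecke_left i (hecke_right i y) = (if y i < y (i + 1) then flip i y else y)"
proof (cases "y i < y (i + 1)")
  case True
  have Sym: "y \<in> Sym n" by (rule involutions_Sym[OF assms])
  have "inv (y \<circ> adj_transp i) = adj_transp i \<circ> y"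
    using Sym_inv_comp_adj[OF Sym] involutions_inv[OF assms] by simp
  moreover have "(adj_transp i \<circ> y) i < (adj_transp i \<circ> y) (i + 1) \<longleftrightarrow> conj_adj i y \<noteq> y"
  proof (cases "conj_adj i y = y")
    case c: True
    then show ?thesis
      using commuting_ascent[OF Sym c True] by (simp add: adj_transp_apply)
  next
    case False
    then show ?thesis
      using adj_transp_less_iff[of "y i" "y (i + 1)" i] conj_adj_eq_iff[OF Sym, of i] True by simp
  qed
  ultimately show ?thesis
    using True by (auto simp: hecke_right_def hecke_left_def flip_def conj_adj_def comp_assoc)
next
  case False
  then show ?thesis
    by (simp add: hecke_right_def hecke_left_def involutions_inv[OF assms])
qed

text \<open>At an ascent both \<open>w \<circ> adj_transp i\<close> and its inverse are Demazure
  products, so associativity puts the two new letters outside.\<close>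

lemma involution_of_ascent:
  assumes w: "w \<in> Sym n" and i: "i \<in> {1..<n}" "w i < w (i + 1)"
  shows "involution_of n (w \<circ> adj_transp i) = hecke_left i (hecke_right i (involution_of n w))"
proof -
  let ?s = "adj_transp i" and ?d = "demazure n"
  have Sym: "?s \<in> Sym n" "inv w \<in> Sym n" "?d (inv w) w \<in> Sym n" "?d w ?s \<in> Sym n"
    using w i by (simp_all add: Sym_adj_transp Sym_inv demazure_Sym)
  have "w \<circ> ?s = ?d w ?s"
    using demazure_adj_right[OF i(1) w] i(2) by (simp add: hecke_right_def)
  moreover have "inv (w \<circ> ?s) = ?d ?s (inv w)"
    using demazure_adj_left[OF i(1) Sym(2)] i(2) w
    by (simp add: hecke_left_def Sym_inv_inv Sym_inv_comp_adj)
  ultimately have "involution_of n (w \<circ> ?s) = ?d (?d ?s (inv w)) (?d w ?s)"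
    unfolding involution_of_def by (simp only:)
  also have "\<dots> = ?d ?s (?d (?d (inv w) w) ?s)"
    using w Sym by (simp add: demazure_assoc demazure_Sym)
  also have "?d (?d (inv w) w) ?s = hecke_right i (?d (inv w) w)"
    by (rule demazure_adj_right[OF i(1) Sym(3)])
  also have "?d ?s \<dots> = hecke_left i \<dots>"
    by (rule demazure_adj_left[OF i(1) hecke_right_Sym[OF i(1) Sym(3)]])
  finally show ?thesis
    by (simp only: involution_of_def)
qed

lemma id_involutions: "id \<in> involutions n"
  by (simp add: involutions_def)

lemma num_two_cycles_id: "num_two_cycles n id = 0"
proof -
  have "{(i, j). 1 \<le> i \<and> i < j \<and> j \<le> n \<and> id i = j \<and> id j = i} = {}"
    by auto
  then show ?thesis
    by (simp only: num_two_cycles_def card.empty)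
qed

text \<open>One more letter raises the left side by 0 or 2 and the right side by 2, so the rank of
  an involution bounds the length of its representatives from below.\<close>

lemma involution_of_bound:
  "w \<in> Sym n \<Longrightarrow> involution_of n w \<in> involutions n \<and>
    inversions n (involution_of n w) + num_two_cycles n (involution_of n w) \<le> 2 * inversions n w"
proof (induction rule: Sym_induct)
  case id
  then show ?case
    unfolding involution_of_id by (simp add: id_involutions num_two_cycles_id del: id_apply)
next
  case (ascent w i)
  have "involution_of n (w \<circ> adj_transp i) \<in> involutions n \<and>
      inversions n (involution_of n (w \<circ> adj_transp i)) + num_two_cycles n (involution_of n (w \<circ> adj_transp i))
      \<le> 2 * inversions n (w \<circ> adj_transp i)"
    using ascent flip_ascent[of "involution_of n w" n i] flip_involutions[of i n "involution_of n w"]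
      inversions_ascent[of i n w]
    by (auto simp: involution_of_ascent hecke_conj)
  then show ?case .
qed

text \<open>A Demazure conjugation by \<open>adj_transp i\<close> always ends in a descent at
  \<open>i\<close>, either created by it or already present.\<close>

lemma involution_of_descent:
  assumes w: "w \<in> Sym n" and i: "i \<in> {1..<n}" "w (i + 1) < w i"
  defines "y \<equiv> involution_of n (w \<circ> adj_transp i)"
  shows "involution_of n w (i + 1) < involution_of n w i"
    and "involution_of n w \<noteq> y \<Longrightarrow> involution_of n w = flip i y"
proof -
  define v where "v = w \<circ> adj_transp i"
  have v: "v \<in> Sym n" "v i < v (i + 1)"
    using w i by (simp_all add: v_def Sym_comp Sym_adj_transp adj_transp_apply)
  have y: "y \<in> involutions n"
    using involution_of_bound[OF v(1)] by (simp add: y_def v_def)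
  have "v \<circ> adj_transp i = w"
    by (simp add: v_def)
  then have "involution_of n w = hecke_left i (hecke_right i y)"
    using involution_of_ascent[OF v(1) i(1) v(2)] by (simp only: y_def v_def)
  then have eq: "involution_of n w = (if y i < y (i + 1) then flip i y else y)"
    by (simp only: hecke_conj[OF y])
  then show "involution_of n w \<noteq> y \<Longrightarrow> involution_of n w = flip i y"
    by (simp split: if_splits)
  show "involution_of n w (i + 1) < involution_of n w i"
    using eq flip_less_iff[OF y, of i] not_ascent_iff[OF involutions_Sym[OF y], of i]
      not_ascent_iff[OF involutions_Sym[OF flip_involutions[OF i(1) y]], of i]
    by (auto split: if_splits)
qed

lemma involution_of_flip:
  assumes y: "y \<in> involutions n" and i: "i \<in> {1..<n}" "y (i + 1) < y i"
    and v: "v \<in> Sym n" "involution_of n v = flip i y"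
  shows "v i < v (i + 1)" "involution_of n (v \<circ> adj_transp i) = y"
proof -
  have asc: "flip i y i < flip i y (i + 1)"
    using flip_less_iff[OF y] i by simp
  then show "v i < v (i + 1)"
    using involution_of_descent(1)[OF v(1) i(1)] not_ascent_iff[OF v(1), of i] v(2) by force
  then show "involution_of n (v \<circ> adj_transp i) = y"
    using involution_of_ascent[OF v(1) i(1)] hecke_conj[OF flip_involutions[OF i(1) y]] asc v(2) flip_flip[OF y]
    by simp
qed

lemma flip_descent:
  assumes "y \<in> involutions n" "i \<in> {1..<n}" "y (i + 1) < y i"
  shows "inversions n y + num_two_cycles n y = inversions n (flip i y) + num_two_cycles n (flip i y) + 2"
    and "inversions n (flip i y) < inversions n y"
    and "num_two_cycles n (flip i y) \<le> num_two_cycles n y"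
  using flip_ascent[OF flip_involutions[OF assms(2,1)] assms(2)] flip_less_iff[OF assms(1)] assms
    flip_flip[OF assms(1)] by simp_all

lemma involution_of_attains_bound:
  "y \<in> involutions n \<Longrightarrow>
    \<exists>w\<in>Sym n. involution_of n w = y \<and> 2 * inversions n w = inversions n y + num_two_cycles n y"
proof (induction "inversions n y" arbitrary: y rule: less_induct)
  case less
  show ?case
  proof (cases "y = id")
    case True
    then show ?thesis
      by (intro bexI[of _ id]) (simp_all add: involution_of_id num_two_cycles_id del: id_apply)
  next
    case False
    then obtain i where i: "i \<in> {1..<n}" "y (i + 1) < y i"
      using Sym_no_descent_imp_id[OF involutions_Sym[OF less.prems]]
        not_ascent_iff[OF involutions_Sym[OF less.prems]] by blast
    note flip = flip_descent[OF less.prems i]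
    obtain v where v: "v \<in> Sym n" "involution_of n v = flip i y"
      "2 * inversions n v = inversions n (flip i y) + num_two_cycles n (flip i y)"
      using less.hyps[OF flip(2) flip_involutions[OF i(1) less.prems]] by blast
    have "v i < v (i + 1)" "involution_of n (v \<circ> adj_transp i) = y"
      using involution_of_flip[OF less.prems i v(1,2)] by simp_all
    moreover have "v \<circ> adj_transp i \<in> Sym n"
      by (intro Sym_comp v Sym_adj_transp i)
    ultimately show ?thesis
      using inversions_ascent[OF i(1), of v] v(3) flip(1)
      by (intro bexI[of _ "v \<circ> adj_transp i"]) simp_all
  qed
qed

text \<open>The bound is attained, so minimality becomes an equation between lengths, which can be
  followed along single edges.\<close>

lemma atoms_eq:
  assumes y: "y \<in> involutions n"
  shows "atoms n y = {w \<in> Sym n. involution_of n w = y \<and>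
    2 * inversions n w = inversions n y + num_two_cycles n y}"
proof -
  obtain v where v: "v \<in> Sym n" "involution_of n v = y" "2 * inversions n v = inversions n y + num_two_cycles n y"
    using involution_of_attains_bound[OF y] by blast
  have "atoms n y = {w \<in> Sym n. involution_of n w = y \<and>
      (\<forall>u\<in>Sym n. involution_of n u = y \<longrightarrow> inversions n w \<le> inversions n u)}"
    by (auto simp: atoms_def min_length_elems_def involution_of_def cox_length_eq_inversions)
  also have "\<dots> = {w \<in> Sym n. involution_of n w = y \<and>
      2 * inversions n w = inversions n y + num_two_cycles n y}"
  proof (intro Collect_cong conj_cong refl iffI)
    fix w assume w: "w \<in> Sym n" "involution_of n w = y"
    assume "\<forall>u\<in>Sym n. involution_of n u = y \<longrightarrow> inversions n w \<le> inversions n u"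
    then have "inversions n w \<le> inversions n v"
      using v by blast
    then show "2 * inversions n w = inversions n y + num_two_cycles n y"
      using involution_of_bound[OF w(1)] w(2) v(3) by simp
  next
    fix w assume w: "2 * inversions n w = inversions n y + num_two_cycles n y"
    show "\<forall>u\<in>Sym n. involution_of n u = y \<longrightarrow> inversions n w \<le> inversions n u"
    proof (intro ballI impI)
      fix u assume "u \<in> Sym n" "involution_of n u = y"
      then show "inversions n w \<le> inversions n u"
        using involution_of_bound[of u n] w by simp
    qed
  qed
  finally show ?thesis .
qed

definition descent :: "nat \<Rightarrow> nat \<Rightarrow> (nat \<Rightarrow> nat) \<Rightarrow> bool" where
  "descent n i y \<longleftrightarrow> i \<in> {1..<n} \<and> y (i + 1) < y i"

lemma involution_atom_graph:
  "atom_graph n (involutions n) id (descent n) flip (atoms n) (num_two_cycles n)"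
proof
  show "id \<in> involutions n" by (rule id_involutions)
next
  fix i show "\<not> descent n i id" by (simp add: descent_def)
next
  fix i y show "descent n i y \<Longrightarrow> i \<in> {1..<n}" by (simp add: descent_def)
next
  fix y assume y: "y \<in> involutions n"
  show "atoms n y \<subseteq> Sym n"
    unfolding atoms_eq[OF y] by blast
  show "id \<in> atoms n y \<longleftrightarrow> y = id"
    using id_involutions by (auto simp: atoms_eq[OF y] involution_of_id num_two_cycles_id simp del: id_apply)
  show "\<exists>i. descent n i y" if "y \<noteq> id"
    unfolding descent_def
    using that Sym_no_descent_imp_id[OF involutions_Sym[OF y]] not_ascent_iff[OF involutions_Sym[OF y]] by blast
  fix i
  {
    assume "descent n i y"
    then have i: "i \<in> {1..<n}" "y (i + 1) < y i" by (simp_all add: descent_def)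
    show "flip i y \<in> involutions n"
      by (rule flip_involutions[OF i(1) y])
    show "inversions n (flip i y) < inversions n y" "num_two_cycles n (flip i y) \<le> num_two_cycles n y"
      using flip_descent[OF y i] by simp_all
    fix v assume "v \<in> atoms n (flip i y)"
    then have v: "v \<in> Sym n" "involution_of n v = flip i y"
      "2 * inversions n v = inversions n (flip i y) + num_two_cycles n (flip i y)"
      by (simp_all add: atoms_eq flip_involutions[OF i(1) y])
    have v': "v i < v (i + 1)" "involution_of n (v \<circ> adj_transp i) = y"
      using involution_of_flip[OF y i v(1,2)] by simp_all
    have "v \<circ> adj_transp i \<in> atoms n y"
      using v v' flip_descent(1)[OF y i] inversions_ascent[OF i(1) v'(1)]
        Sym_comp[OF v(1) Sym_adj_transp[OF i(1)]]
      by (simp add: atoms_eq[OF y])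
    with v' show "v i < v (i + 1) \<and> v \<circ> adj_transp i \<in> atoms n y" by simp
  next
    fix w assume w: "w \<in> atoms n y" and i: "i \<in> {1..<n}" "w (i + 1) < w i"
    have w: "w \<in> Sym n" "involution_of n w = y" "2 * inversions n w = inversions n y + num_two_cycles n y"
      using w by (simp_all add: atoms_eq[OF y])
    define v where "v = w \<circ> adj_transp i"
    have v: "v \<in> Sym n" "inversions n w = Suc (inversions n v)"
      using w i inversions_descent[OF i] by (simp_all add: v_def Sym_comp Sym_adj_transp)
    have desc: "y (i + 1) < y i"
      using involution_of_descent(1)[OF w(1) i] w(2) by simp
    \<comment> \<open>Otherwise the shorter \<open>v\<close> would represent \<open>y\<close> below
      the lower bound.\<close>
    have "involution_of n v \<noteq> y"
      using involution_of_bound[OF v(1)] v(2) w(3) by auto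
    then have "y = flip i (involution_of n v)"
      using involution_of_descent(2)[OF w(1) i] w(2) by (simp add: v_def)
    then have "flip i y = involution_of n v"
      using flip_flip involution_of_bound[OF v(1)] by metis
    then have "v \<in> atoms n (flip i y)"
      using v w(3) flip_descent(1)[OF y i(1) desc]
      unfolding atoms_eq[OF flip_involutions[OF i(1) y]] by simp
    then show "descent n i y \<and> w \<circ> adj_transp i \<in> atoms n (flip i y)"
      using i(1) desc by (simp add: v_def descent_def)
  }
qed

section \<open>Unit vectors and the turning relation at the identity\<close>

lemma nil_op_delta:
  assumes "i \<in> {1..<n}" "v i < v (i + 1)"
  shows "nil_op n i (delta v) = delta (v \<circ> adj_transp i)"
proof
  fix w
  have "w \<circ> adj_transp i = v \<longleftrightarrow> w = v \<circ> adj_transp i"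
    by auto
  moreover have "w (i + 1) < w i" if "w = v \<circ> adj_transp i"
    using assms(2) that by (simp add: adj_transp_apply)
  ultimately show "nil_op n i (delta v) w = delta (v \<circ> adj_transp i) w"
    using assms(1) by (auto simp: nil_op_def delta_def)
qed

lemma nil_op_delta_id: "i \<in> {1..<n} \<Longrightarrow> nil_op n i (delta id) = delta (adj_transp i)"
  using nil_op_delta[of i n id] by simp

lemma nil_op_delta_adj:
  "i \<in> {1..<n} \<Longrightarrow> j = i + 1 \<or> i = j + 1 \<Longrightarrow>
    nil_op n i (delta (adj_transp j)) = delta (adj_transp j \<circ> adj_transp i)"
  by (rule nil_op_delta) (auto simp: adj_transp_apply)

context atom_graph
begin

lemma proj_cong: "proj f = proj g \<Longrightarrow> proj (regular.run n L f) = proj (regular.run n L g)"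
  by (simp add: proj_run)

lemma proj_step_cong: "proj f = proj g \<Longrightarrow> proj (regular.step n i x f) = proj (regular.step n i x g)"
  using proj_cong[of f g "[(i, x)]"] by simp

lemma proj_step: "proj (regular.step n i x f) = atomic.step i x (proj f)"
  using proj_run[of "[(i, x)]" f] by simp

end

text \<open>The involution obtained is symmetric in \<open>i\<close> and \<open>j\<close> by the
  braid relation. Hence the two products of adjacent generators are atoms of the same involution,
  although they differ as permutations.\<close>

lemma involution_of_adj_adj:
  assumes "i \<in> {1..<n}" "j \<in> {1..<n}" "j = i + 1 \<or> i = j + 1"
  shows "involution_of n (adj_transp j \<circ> adj_transp i) = adj_transp i \<circ> adj_transp j \<circ> adj_transp i"
    and "inversions n (adj_transp j \<circ> adj_transp i) = 2"
proof -
  have j: "adj_transp j i < adj_transp j (i + 1)"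
    using assms(3) by (auto simp: adj_transp_apply)
  have "conj_adj j id = id"
    by (simp add: conj_adj_def)
  then have "involution_of n (adj_transp j) = adj_transp j"
    using involution_of_ascent[OF Sym_id assms(2)] hecke_conj[OF id_involutions, of j]
    by (simp add: involution_of_id flip_def)
  moreover have "adj_transp j \<in> involutions n"
    using Sym_adj_transp[OF assms(2)] by (simp add: involutions_def)
  ultimately have "involution_of n (adj_transp j \<circ> adj_transp i) = flip i (adj_transp j)"
    using involution_of_ascent[OF Sym_adj_transp[OF assms(2)] assms(1) j] hecke_conj[of "adj_transp j" n i] j
    by simp
  moreover have "conj_adj i (adj_transp j) i \<noteq> adj_transp j i"
    using assms(3) by (auto simp: conj_adj_apply adj_transp_apply)
  then have "conj_adj i (adj_transp j) \<noteq> adj_transp j"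
    by auto
  ultimately show "involution_of n (adj_transp j \<circ> adj_transp i) = adj_transp i \<circ> adj_transp j \<circ> adj_transp i"
    by (simp add: flip_def conj_adj_def)
  show "inversions n (adj_transp j \<circ> adj_transp i) = 2"
    using inversions_ascent[OF assms(1) j] inversions_adj_transp[OF assms(2)] by simp
qed

theorem positive_inv_schubert:
  assumes y: "y \<in> involutions n"
  shows "positive_int_combination
    (products {var i + var j | i j. 1 \<le> i \<and> i \<le> j \<and> j \<le> n})
    (2 ^ num_two_cycles n y * inv_schubert n y)"
proof -
  let ?G = "{var i + var j | i j. 1 \<le> i \<and> i \<le> j \<and> j \<le> n}"
  interpret atom_graph n "involutions n" id "descent n" flip
    "atoms n" "num_two_cycles n"
    by (rule involution_atom_graph)
  let ?\<delta> = "delta id :: (nat \<Rightarrow> nat) \<Rightarrow> int_mpoly"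
  have adj: "proj (regular.step n i x (regular.step n (i + 1) x ?\<delta>)) =
      proj (regular.step n (i + 1) x (regular.step n i x ?\<delta>))" if "1 \<le> i" for i x
  proof (cases "i + 1 < n")
    case True
    then have i: "i \<in> {1..<n}" "i + 1 \<in> {1..<n}"
      using that by auto
    have "proj (nil_op n i (nil_op n (i + 1) ?\<delta>)) = proj (nil_op n (i + 1) (nil_op n i ?\<delta>))"
    proof
      fix y
      have "adj_transp (i + 1) \<circ> adj_transp i \<in> atoms n y \<longleftrightarrow> adj_transp i \<circ> adj_transp (i + 1) \<in> atoms n y"
        if "y \<in> involutions n"
        using i involution_of_adj_adj[of i n "i + 1"] involution_of_adj_adj[of "i + 1" n i]
          adj_transp_braid[of i]
        by (simp add: atoms_eq[OF that] Sym_comp Sym_adj_transp)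
      then show "proj (nil_op n i (nil_op n (i + 1) ?\<delta>)) y = proj (nil_op n (i + 1) (nil_op n i ?\<delta>)) y"
        using i by (auto simp: nil_op_delta_id nil_op_delta_adj proj_delta)
    qed
    then have "atom_op i (atom_op (i + 1) (proj ?\<delta>)) = atom_op (i + 1) (atom_op i (proj ?\<delta>))"
      by (simp only: proj_nil_op)
    then show ?thesis
      unfolding proj_step atomic.step_def atomic.U_lin by (simp add: algebra_simps)
  next
    case False
    then show ?thesis by (simp add: regular.step_vanish)
  qed
  \<comment> \<open>Reverse the part above \<open>i\<close> by induction, push \<open>i\<close>
    inward past the letters from \<open>i + 2\<close> on, and exchange it with \<open>i + 1\<close>
    at the identity.\<close>
  have turn: "proj (regular.run n (regular.down n i x) ?\<delta>) = proj (regular.run n (regular.up n i x) ?\<delta>)"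
    if "1 \<le> i" for i x
    using that
  proof (induction "n - i" arbitrary: i)
    case 0
    then show ?case by (simp add: regular.down_empty regular.up_empty)
  next
    case (Suc m)
    have comm: "regular.run n (regular.up n (i + 1 + 1) x) (regular.step n i x f) =
        regular.step n i x (regular.run n (regular.up n (i + 1 + 1) x) f)"
      for f :: "(nat \<Rightarrow> nat) \<Rightarrow> int_mpoly"
      by (rule regular.run_step_commute, unfold regular.fst_set_up) auto
    have "proj (regular.run n (regular.down n i x) ?\<delta>) =
        proj (regular.step n i x (regular.run n (regular.down n (i + 1) x) ?\<delta>))"
      by (simp only: regular.run_down_rec[of n i])
    also have "\<dots> = proj (regular.step n i x (regular.run n (regular.up n (i + 1) x) ?\<delta>))"
      using Suc.hyps by (intro proj_step_cong Suc.hyps(1)) linarith+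
    also have "\<dots> = proj (regular.run n (regular.up n (i + 1 + 1) x) (regular.step n i x (regular.step n (i + 1) x ?\<delta>)))"
      unfolding regular.run_up_rec[of n "i + 1"] comm ..
    also have "\<dots> = proj (regular.run n (regular.up n (i + 1 + 1) x) (regular.step n (i + 1) x (regular.step n i x ?\<delta>)))"
      by (rule proj_cong[OF adj[OF Suc.prems]])
    also have "\<dots> = proj (regular.run n (regular.up n i x) ?\<delta>)"
      by (simp only: regular.run_up_rec[of n i] regular.run_up_rec[of n "i + 1"])
    finally show ?case .
  qed
  \<comment> \<open>Each turned string leaves its lowest letter without a partner.
    \<open>diag\<close> collects these letters, and \<open>v k\<close> is the vector met by the next
    string.\<close>
  define diag where "diag k = map (\<lambda>i. (2 * i - 1, var i)) [1..<k + 1]" for k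
  define v where "v k = regular.run n (diag k) ?\<delta>" for k
  have diag_Suc: "diag (k + 1) = diag k @ [(2 * k + 1, var (k + 1))]" for k
    by (simp add: diag_def)
  have v_Suc: "v (k + 1) = regular.step n (2 * k + 1) (var (k + 1)) (v k)" for k
    unfolding v_def diag_Suc by simp
  have "proj (regular.run n (regular.down n (2 * k + 1) (var (k + 1))) (v k)) =
      proj (regular.run n (regular.up n (2 * k + 2) (var (k + 1))) (v (k + 1)))" for k
  proof -
    \<comment> \<open>The letters of \<open>diag k\<close> are at most \<open>2 * k - 1\<close>, so
      a string from \<open>2 * k + 1\<close> passes them and turns at the identity.\<close>
    have comm: "regular.run n L (v k) = regular.run n (diag k) (regular.run n L ?\<delta>)"
      if "fst ` set L = {2 * k + 1..<n}" for L
      unfolding v_def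
      by (rule regular.run_run_commute) (use that in \<open>auto simp: diag_def\<close>)
    have "proj (regular.run n (regular.down n (2 * k + 1) (var (k + 1))) (v k)) =
        proj (regular.run n (regular.up n (2 * k + 1) (var (k + 1))) (v k))"
      unfolding comm[OF regular.fst_set_down] comm[OF regular.fst_set_up]
      by (rule proj_cong[OF turn]) simp
    also have "\<dots> = proj (regular.run n (regular.up n (2 * k + 2) (var (k + 1))) (v (k + 1)))"
      unfolding v_Suc by (simp add: regular.run_up_rec[of n "Suc (2 * k)"])
    finally show ?thesis .
  qed
  moreover have "v 0 = ?\<delta>"
    by (simp add: v_def diag_def)
  text \<open>
    A factor \<open>2 k + 1\<close> of the diagonal finds the points \<open>2 k + 1\<close> and \<open>2 k + 2\<close> fixed, so it creates a
    new cycle; this compensates for the missing factor 2 in its weight \<open>var (k + 1)\<close>.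
  \<close>
  moreover have "good ?G (proj (v k)) \<and> (\<forall>y\<in>involutions n. proj (v k) y \<noteq> 0 \<longrightarrow> (\<forall>a>2 * k. y a = a))"
    if "k \<le> n" for k
    using that
  proof (induction k)
    case 0
    have "proj (v 0) = delta id"
      by (simp add: v_def diag_def proj_delta_id)
    then show ?case
      by (auto simp: good_def delta_def nonneg_one nonneg_combinations.zero num_two_cycles_id
          simp del: id_apply split: if_splits) simp
  next
    case (Suc k)
    define f where "f = proj (v k)"
    define a where "a = 2 * k + 1"
    have good: "good ?G f" and supp: "\<And>y b. y \<in> involutions n \<Longrightarrow> f y \<noteq> 0 \<Longrightarrow> 2 * k < b \<Longrightarrow> y b = b"
      using Suc by (auto simp: f_def)
    have f_Suc: "proj (v (Suc k)) y = f y + var (k + 1) * atom_op a f y" for y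
      using v_Suc[of k] by (simp add: proj_step atomic.step_def f_def a_def)
    have new: "y = flip a y \<circ> adj_transp a \<and> num_two_cycles n y = Suc (num_two_cycles n (flip a y))"
      if y: "y \<in> involutions n" "a \<in> {1..<n}" "y (a + 1) < y a" "f (flip a y) \<noteq> 0" for y
    proof -
      have z: "flip a y \<in> involutions n"
        by (rule flip_involutions[OF y(2,1)])
      have fix_a: "flip a y a = a" "flip a y (a + 1) = a + 1"
        using supp[OF z y(4)] by (simp_all add: a_def)
      then have "conj_adj a (flip a y) = flip a y"
        by (simp add: conj_adj_eq_iff[OF involutions_Sym[OF z]])
      then have "y = flip a y \<circ> adj_transp a"
        "num_two_cycles n (flip a y \<circ> adj_transp a) = Suc (num_two_cycles n (flip a y))"
        using flip_flip[OF y(1), of a] num_two_cycles_commuting[OF z y(2)] fix_a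
        by (simp_all add: flip_def[of a "flip a y"])
      then show ?thesis by metis
    qed
    have "2 ^ num_two_cycles n y * (var (k + 1) * atom_op a f y) \<in> nonneg_combinations ?G"
      if y: "y \<in> involutions n" for y
    proof (cases "atom_op a f y = 0")
      case False
      then have a: "a \<in> {1..<n}" "y (a + 1) < y a" "f (flip a y) \<noteq> 0" and op: "atom_op a f y = f (flip a y)"
        by (auto simp: atom_op_def descent_def split: if_splits)
      have "2 ^ num_two_cycles n y * (var (k + 1) * atom_op a f y) =
          (var (k + 1) + var (k + 1)) * (2 ^ num_two_cycles n (flip a y) * f (flip a y))"
        using new[OF y a] unfolding op by (simp add: algebra_simps)
      \<comment> \<open>Here the claim is used only in the range where the index of the variable is
        at most \<open>n\<close>.\<close>
      moreover have "var (k + 1) + var (k + 1) \<in> ?G"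
        using Suc.prems by force
      moreover have "2 ^ num_two_cycles n (flip a y) * f (flip a y) \<in> nonneg_combinations ?G"
        using good flip_involutions[OF a(1) y] by (simp add: good_def)
      ultimately show ?thesis
        by (simp only: nonneg_mult)
    qed (simp add: nonneg_combinations.zero)
    then have "good ?G (proj (v (Suc k)))"
      using good unfolding good_def f_Suc by (auto simp: distrib_left intro: nonneg_add)
    moreover have "y b = b" if y: "y \<in> involutions n" "proj (v (Suc k)) y \<noteq> 0" and b: "2 * Suc k < b" for y b
    proof (cases "f y = 0")
      case True
      then have a: "a \<in> {1..<n}" "y (a + 1) < y a" "f (flip a y) \<noteq> 0"
        using y(2) by (auto simp: f_Suc atom_op_def descent_def split: if_splits)
      have "flip a y b = b"
        using supp[OF flip_involutions[OF a(1) y(1)] a(3)] b by simp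
      moreover have "y b = (flip a y \<circ> adj_transp a) b"
        using new[OF y(1) a] by simp
      ultimately show ?thesis
        using b by (simp add: adj_transp_apply a_def)
    next
      case False
      then show ?thesis
        using supp[OF y(1)] b by simp
    qed
    ultimately show ?case by blast
  qed
  then have "good ?G (proj (v n))" by blast
  ultimately have "positive_int_combination (products ?G) (2 ^ num_two_cycles n y * atom_schubert y)"
    using y by (intro positive_atom_schubert[of v]) force+
  then show ?thesis
    using y by (simp add: atom_schubert_eq inv_schubert_def)
qed

section \<open>Atoms of fixed-point-free involutions\<close>

lemma fpf_involutions_involutions: "z \<in> fpf_involutions n \<Longrightarrow> z \<in> involutions n"
  by (simp add: fpf_involutions_def)

lemma fpf_involutions_Sym: "z \<in> fpf_involutions n \<Longrightarrow> z \<in> Sym n"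
  by (simp add: fpf_involutions_def involutions_Sym)

lemma fpf_involutions_conj_adj:
  assumes "i \<in> {1..<n}" "z \<in> fpf_involutions n"
  shows "conj_adj i z \<in> fpf_involutions n"
proof -
  have "conj_adj i z a \<noteq> a" if "a \<in> {1..n}" for a
  proof
    assume "conj_adj i z a = a"
    then have "z (adj_transp i a) = adj_transp i a"
      by (metis adj_transp_involutory conj_adj_apply)
    moreover have "adj_transp i a \<in> {1..n}"
      using Sym_range[OF Sym_adj_transp[OF assms(1)]] that by blast
    ultimately show False
      using assms(2) by (auto simp: fpf_involutions_def)
  qed
  then show ?thesis
    using assms conj_adj_involutions by (auto simp: fpf_involutions_def)
qed

lemma even_card_fpf:
  assumes "z \<in> fpf_involutions n"
  shows "even n"
proof -
  have z: "z \<in> involutions n" and "\<forall>i\<in>{1..n}. z i \<noteq> i"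
    using assms by (simp_all add: fpf_involutions_def)
  then have "{a. z a \<noteq> a} = {1..n}"
    using Sym_fixes[OF involutions_Sym[OF z]] by blast
  then show ?thesis
    using num_two_cycles_eq[OF z] by (metis card_atLeastAtMost diff_Suc_1 dvd_triv_left)
qed

lemma one_fpf_apply:
  assumes "even n"
  shows "one_fpf n a = (if a \<in> {1..n} then if odd a then a + 1 else a - 1 else a)"
proof -
  have "one_fpf (2 * m) a = (if a \<in> {1..2 * m} then if odd a then a + 1 else a - 1 else a)" for m a
  proof (induction m arbitrary: a)
    case 0
    then show ?case by (simp add: one_fpf_def)
  next
    case (Suc m)
    \<comment> \<open>For \<open>m = 0\<close> the entry \<open>2 * m\<close> would be 0, which lies
      outside the range.\<close>
    have "[1..<2 * Suc m] = [1..<2 * m] @ (if m = 0 then [1] else [2 * m, 2 * m + 1])"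
      by (cases m) (simp_all add: numeral_2_eq_2)
    then have "one_fpf (2 * Suc m) = one_fpf (2 * m) \<circ> adj_transp (2 * m + 1)"
      by (simp add: one_fpf_def del: upt_Suc)
    then show ?case
      using Suc by (auto simp: adj_transp_apply)
  qed
  then show ?thesis
    using assms by auto
qed

lemma one_fpf_fpf_involutions:
  assumes "even n"
  shows "one_fpf n \<in> fpf_involutions n"
proof -
  have "one_fpf n \<in> Sym n"
    unfolding one_fpf_def by (rule word_perm_Sym) auto
  then have "one_fpf n \<in> involutions n"
  proof (rule involutionsI)
    fix a
    have "a < n" if "odd a" "a \<le> n"
      using assms that by (metis le_neq_implies_less)
    then show "one_fpf n (one_fpf n a) = a"
      using assms by (auto simp: one_fpf_apply)
  qed
  then show ?thesis
    using assms by (auto simp: fpf_involutions_def one_fpf_apply)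
qed

lemma conj_adj_one_fpf:
  assumes "even n" "i \<in> {1..<n}" "odd i"
  shows "conj_adj i (one_fpf n) = one_fpf n"
  using assms conj_adj_eq_iff[OF fpf_involutions_Sym[OF one_fpf_fpf_involutions[OF assms(1)]], of i]
  by (auto simp: one_fpf_apply)

text \<open>A descent with \<open>z i = i + 1\<close> is excluded because conjugation then fixes
  \<open>z\<close>. The base point has such descents at the odd indices and no others.\<close>

definition fpf_descent :: "nat \<Rightarrow> nat \<Rightarrow> (nat \<Rightarrow> nat) \<Rightarrow> bool" where
  "fpf_descent n i z \<longleftrightarrow> i \<in> {1..<n} \<and> z (i + 1) < z i \<and> z i \<noteq> i + 1"

lemma conj_adj_fpf:
  assumes z: "z \<in> fpf_involutions n" and i: "i \<in> {1..<n}"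
  shows "conj_adj i z = z \<longleftrightarrow> z i = i + 1"
proof -
  have "z i \<noteq> i" and inv: "z (z i) = i"
    using z i by (auto simp: fpf_involutions_def involutions_apply)
  then show ?thesis
    using conj_adj_eq_iff[OF fpf_involutions_Sym[OF z], of i] by (auto simp: doubleton_eq_iff)
qed

lemma fpf_descent_inversions:
  assumes z: "z \<in> fpf_involutions n" and i: "fpf_descent n i z"
  shows "inversions n z = inversions n (conj_adj i z) + 2"
proof -
  have ne: "conj_adj i z \<noteq> z"
    using i conj_adj_fpf[OF z] by (auto simp: fpf_descent_def)
  then show ?thesis
    using inversions_conj_adj[of "conj_adj i z" n i] conj_adj_less_iff[OF fpf_involutions_Sym[OF z] ne]
      fpf_involutions_conj_adj[OF _ z, of i] i
    by (simp add: fpf_descent_def fpf_involutions_involutions)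
qed

lemma inversions_conj_adj_le:
  assumes z: "z \<in> fpf_involutions n" and i: "i \<in> {1..<n}" and "\<not> fpf_descent n i z"
  shows "inversions n (conj_adj i z) = (if z i = i + 1 then inversions n z else inversions n z + 2)"
proof (cases "z i = i + 1")
  case True
  then show ?thesis
    using conj_adj_fpf[OF z i] by simp
next
  case False
  then have "z i < z (i + 1)"
    using assms not_ascent_iff[OF fpf_involutions_Sym[OF z], of i] by (auto simp: fpf_descent_def)
  then show ?thesis
    using inversions_conj_adj[OF fpf_involutions_involutions[OF z] i] conj_adj_fpf[OF z i] False by simp
qed

text \<open>Otherwise the pairs of neighbours are forced from left to right: the first unmatched
  point \<open>i\<close> must be matched with \<open>i + 1\<close>, since a partner further right
  would produce a descent just before it.\<close>

lemma fpf_descent_exists: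
  assumes z: "z \<in> fpf_involutions n" and ne: "z \<noteq> one_fpf n"
  shows "\<exists>i. fpf_descent n i z"
proof (rule ccontr)
  assume no: "\<nexists>i. fpf_descent n i z"
  have n: "even n" by (rule even_card_fpf[OF z])
  have Sym: "z \<in> Sym n" by (rule fpf_involutions_Sym[OF z])
  have invol: "z (z a) = a" for a
    by (rule involutions_apply[OF fpf_involutions_involutions[OF z]])
  have agree: "\<forall>j\<in>{1..2 * m}. z j = one_fpf n j" if "2 * m \<le> n" for m
    using that
  proof (induction m)
    case (Suc m)
    define i where "i = 2 * m + 1"
    have below: "z j \<in> {1..2 * m}" if "j \<in> {1..2 * m}" for j
      using Suc that n by (auto simp: one_fpf_apply) presburger+
    have above: "2 * m < z j" if "2 * m < j" "j \<le> n" for j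
    proof (rule ccontr)
      assume "\<not> 2 * m < z j"
      moreover have "z j \<in> {1..n}"
        using Sym_range[OF Sym, of j] that by simp
      ultimately have "z (z j) \<in> {1..2 * m}"
        using below[of "z j"] by simp
      then show False
        using that by (simp add: invol)
    qed
    have i: "i \<in> {1..n}" "i < n"
      using Suc.prems by (auto simp: i_def)
    have "z i \<noteq> i"
      using z i by (simp add: fpf_involutions_def)
    have "z i = i + 1"
    proof (rule ccontr)
      assume "z i \<noteq> i + 1"
      then have p: "i + 1 < z i" "z i \<le> n"
        using above[of i] i \<open>z i \<noteq> i\<close> Sym_range[OF Sym, of i] by (auto simp: i_def)
      \<comment> \<open>The position just before the partner of \<open>i\<close>: the value at
        \<open>p + 1\<close> is \<open>i\<close>, the smallest one left, so \<open>p\<close> is a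
        descent. Its only excuse, \<open>z p = p + 1\<close>, would give \<open>p\<close> the same
        value as \<open>i\<close>.\<close>
      define p where "p = z i - 1"
      have p_eq: "p + 1 = z i" "p \<in> {1..<n}" "i < p"
        using p by (auto simp: p_def)
      have "z p \<noteq> i"
        using p_eq invol by (metis add_eq_self_zero one_neq_zero)
      then have "z (p + 1) < z p"
        using above[of p] p_eq by (simp add: invol i_def)
      then have "z p = p + 1"
        using no p_eq(2) unfolding fpf_descent_def by blast
      then have "z p = z i"
        using p_eq by simp
      then show False
        using p_eq Sym_inj[OF Sym] by simp
    qed
    moreover from this have "z (i + 1) = i"
      using invol by metis
    moreover have "{1..2 * Suc m} = {1..2 * m} \<union> {i, i + 1}"
      by (auto simp: i_def)
    ultimately show ?case
      using Suc n i by (auto simp: one_fpf_apply i_def)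
  qed simp
  have "z a = one_fpf n a" for a
  proof (cases "a \<in> {1..n}")
    case True
    then show ?thesis
      using agree[of "n div 2"] n by simp
  next
    case False
    then show ?thesis
      using Sym_fixes[OF Sym] n by (auto simp: one_fpf_apply)
  qed
  then show False
    using ne by auto
qed

section \<open>Conjugates of the base point and their shortest conjugators\<close>

definition fpf_of :: "nat \<Rightarrow> (nat \<Rightarrow> nat) \<Rightarrow> nat \<Rightarrow> nat" where
  "fpf_of n w = inv w \<circ> one_fpf n \<circ> w"

lemma fpf_of_id: "fpf_of n id = one_fpf n"
  by (simp add: fpf_of_def)

lemma fpf_of_comp_adj: "w \<in> Sym n \<Longrightarrow> fpf_of n (w \<circ> adj_transp i) = conj_adj i (fpf_of n w)"
  by (simp add: fpf_of_def Sym_inv_comp_adj conj_adj_def comp_assoc del: comp_apply)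

lemma fpf_of_bound:
  assumes "even n"
  shows "w \<in> Sym n \<Longrightarrow> fpf_of n w \<in> fpf_involutions n \<and>
    inversions n (fpf_of n w) \<le> inversions n (one_fpf n) + 2 * inversions n w"
proof (induction rule: Sym_induct)
  case id
  then show ?case
    unfolding fpf_of_id using one_fpf_fpf_involutions[OF assms] by simp
next
  case (ascent w i)
  have "inversions n (conj_adj i (fpf_of n w)) \<le> inversions n (fpf_of n w) + 2"
    using ascent fpf_descent_inversions[of "fpf_of n w" n i] inversions_conj_adj_le[of "fpf_of n w" n i]
    by (cases "fpf_descent n i (fpf_of n w)") auto
  then have "fpf_of n (w \<circ> adj_transp i) \<in> fpf_involutions n \<and>
      inversions n (fpf_of n (w \<circ> adj_transp i))
      \<le> inversions n (one_fpf n) + 2 * inversions n (w \<circ> adj_transp i)"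
    using ascent fpf_involutions_conj_adj inversions_ascent[of i n w]
    by (simp add: fpf_of_comp_adj)
  then show ?case .
qed

lemma fpf_of_conj_adj:
  assumes z: "z \<in> fpf_involutions n" and i: "fpf_descent n i z"
    and v: "v \<in> Sym n" "fpf_of n v = conj_adj i z"
    "inversions n (conj_adj i z) = inversions n (one_fpf n) + 2 * inversions n v"
  shows "v i < v (i + 1)" "fpf_of n (v \<circ> adj_transp i) = z"
    "inversions n z = inversions n (one_fpf n) + 2 * inversions n (v \<circ> adj_transp i)"
proof -
  have n: "even n" by (rule even_card_fpf[OF z])
  have i': "i \<in> {1..<n}" using i by (simp add: fpf_descent_def)
  show eq: "fpf_of n (v \<circ> adj_transp i) = z"
    using v by (simp add: fpf_of_comp_adj)
  have "v \<circ> adj_transp i \<in> Sym n"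
    by (intro Sym_comp v Sym_adj_transp i')
  then have "inversions n z \<le> inversions n (one_fpf n) + 2 * inversions n (v \<circ> adj_transp i)"
    using fpf_of_bound[OF n] eq by metis
  then show "v i < v (i + 1)"
    using fpf_descent_inversions[OF z i] v(3) inversions_descent[OF i', of v] not_ascent_iff[OF v(1), of i]
    by force
  then show "inversions n z = inversions n (one_fpf n) + 2 * inversions n (v \<circ> adj_transp i)"
    using fpf_descent_inversions[OF z i] v(3) inversions_ascent[OF i', of v] by simp
qed

lemma fpf_of_attains_bound:
  "z \<in> fpf_involutions n \<Longrightarrow>
    \<exists>w\<in>Sym n. fpf_of n w = z \<and> inversions n z = inversions n (one_fpf n) + 2 * inversions n w"
proof (induction "inversions n z" arbitrary: z rule: less_induct)
  case less
  show ?case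
  proof (cases "z = one_fpf n")
    case True
    then show ?thesis
      by (intro bexI[of _ id]) (simp_all add: fpf_of_id del: id_apply)
  next
    case False
    then obtain i where i: "fpf_descent n i z"
      using fpf_descent_exists less.prems by blast
    then have i': "i \<in> {1..<n}" by (simp add: fpf_descent_def)
    have "inversions n (conj_adj i z) < inversions n z"
      using fpf_descent_inversions[OF less.prems i] by simp
    then obtain v where v: "v \<in> Sym n" "fpf_of n v = conj_adj i z"
      "inversions n (conj_adj i z) = inversions n (one_fpf n) + 2 * inversions n v"
      using less.hyps fpf_involutions_conj_adj[OF i' less.prems] by blast
    have "v \<circ> adj_transp i \<in> Sym n"
      by (intro Sym_comp v Sym_adj_transp i')
    then show ?thesis
      using fpf_of_conj_adj[OF less.prems i v] by blast
  qed
qed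

text \<open>One letter changes the inversions by at most 2 and the bound is attained, so the length
  of an atom is half the excess of inversions over the base point.\<close>

lemma fpf_atoms_eq:
  assumes z: "z \<in> fpf_involutions n"
  shows "fpf_atoms n z = {w \<in> Sym n. fpf_of n w = z \<and>
    inversions n z = inversions n (one_fpf n) + 2 * inversions n w}"
proof -
  have n: "even n" by (rule even_card_fpf[OF z])
  obtain v where v: "v \<in> Sym n" "fpf_of n v = z"
    "inversions n z = inversions n (one_fpf n) + 2 * inversions n v"
    using fpf_of_attains_bound[OF z] by blast
  have "fpf_atoms n z = {w \<in> Sym n. fpf_of n w = z \<and>
      (\<forall>u\<in>Sym n. fpf_of n u = z \<longrightarrow> inversions n w \<le> inversions n u)}"
    by (auto simp: fpf_atoms_def min_length_elems_def fpf_of_def cox_length_eq_inversions)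
  also have "\<dots> = {w \<in> Sym n. fpf_of n w = z \<and>
      inversions n z = inversions n (one_fpf n) + 2 * inversions n w}"
  proof (intro Collect_cong conj_cong refl iffI)
    fix w assume w: "w \<in> Sym n" "fpf_of n w = z"
    assume "\<forall>u\<in>Sym n. fpf_of n u = z \<longrightarrow> inversions n w \<le> inversions n u"
    then have "inversions n w \<le> inversions n v"
      using v by blast
    then show "inversions n z = inversions n (one_fpf n) + 2 * inversions n w"
      using fpf_of_bound[OF n w(1)] w(2) v(3) by simp
  next
    fix w assume w: "inversions n z = inversions n (one_fpf n) + 2 * inversions n w"
    show "\<forall>u\<in>Sym n. fpf_of n u = z \<longrightarrow> inversions n w \<le> inversions n u"
    proof (intro ballI impI)
      fix u assume "u \<in> Sym n" "fpf_of n u = z"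
      then show "inversions n w \<le> inversions n u"
        using fpf_of_bound[OF n, of u] w by simp
    qed
  qed
  finally show ?thesis .
qed

lemma fpf_atom_graph:
  assumes n: "even n"
  shows "atom_graph n (fpf_involutions n) (one_fpf n) (fpf_descent n) conj_adj (fpf_atoms n) (\<lambda>_. 0)"
proof
  show base: "one_fpf n \<in> fpf_involutions n"
    by (rule one_fpf_fpf_involutions[OF n])
  show "\<not> fpf_descent n i (one_fpf n)" for i
    using n by (auto simp: fpf_descent_def one_fpf_apply split: if_splits)
next
  show "i \<in> {1..<n}" if "fpf_descent n i y" for i y
    using that by (simp add: fpf_descent_def)
next
  fix z assume z: "z \<in> fpf_involutions n"
  show "fpf_atoms n z \<subseteq> Sym n"
    unfolding fpf_atoms_eq[OF z] by blast
  show "id \<in> fpf_atoms n z \<longleftrightarrow> z = one_fpf n"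
    unfolding fpf_atoms_eq[OF z] by (auto simp: fpf_of_id simp del: id_apply)
  show "\<exists>i. fpf_descent n i z" if "z \<noteq> one_fpf n"
    using that by (rule fpf_descent_exists[OF z])
  fix i
  {
    assume i: "fpf_descent n i z"
    then have i': "i \<in> {1..<n}" by (simp add: fpf_descent_def)
    show cz: "conj_adj i z \<in> fpf_involutions n"
      by (rule fpf_involutions_conj_adj[OF i' z])
    show "inversions n (conj_adj i z) < inversions n z"
      using fpf_descent_inversions[OF z i] by simp
    fix v assume "v \<in> fpf_atoms n (conj_adj i z)"
    then have v: "v \<in> Sym n" "fpf_of n v = conj_adj i z"
      "inversions n (conj_adj i z) = inversions n (one_fpf n) + 2 * inversions n v"
      unfolding fpf_atoms_eq[OF cz] by blast+
    show "v i < v (i + 1) \<and> v \<circ> adj_transp i \<in> fpf_atoms n z"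
      using fpf_of_conj_adj[OF z i v] Sym_comp[OF v(1) Sym_adj_transp[OF i']]
      unfolding fpf_atoms_eq[OF z] by blast
  next
    fix w assume "w \<in> fpf_atoms n z" and i: "i \<in> {1..<n}" "w (i + 1) < w i"
    then have w: "w \<in> Sym n" "fpf_of n w = z" "inversions n z = inversions n (one_fpf n) + 2 * inversions n w"
      unfolding fpf_atoms_eq[OF z] by blast+
    define v where "v = w \<circ> adj_transp i"
    have v: "v \<in> Sym n" "inversions n w = Suc (inversions n v)" "fpf_of n v = conj_adj i z"
      using w i inversions_descent[OF i]
      by (simp_all add: v_def Sym_comp Sym_adj_transp fpf_of_comp_adj)
    \<comment> \<open>Dropping a letter lowers the bound by 2, so conjugation must remove
      inversions; that happens only at an \<open>fpf_descent\<close>.\<close>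
    have "inversions n (conj_adj i z) < inversions n z"
      using fpf_of_bound[OF n v(1)] v w(3) by simp
    then have desc: "fpf_descent n i z"
      using inversions_conj_adj_le[OF z i(1)] by (cases "fpf_descent n i z") (simp_all split: if_splits)
    then have "v \<in> fpf_atoms n (conj_adj i z)"
      using v w(3) fpf_descent_inversions[OF z desc]
      unfolding fpf_atoms_eq[OF fpf_involutions_conj_adj[OF i(1) z]] by simp
    then show "fpf_descent n i z \<and> w \<circ> adj_transp i \<in> fpf_atoms n (conj_adj i z)"
      using desc by (simp add: v_def)
  }
qed simp

text \<open>On the four points from \<open>p\<close> to \<open>p + 3\<close>, the cycles first
  become \<open>p, p + 2\<close> and \<open>p + 1, p + 3\<close>; either further conjugation nests
  them as \<open>p, p + 3\<close> and \<open>p + 1, p + 2\<close>.\<close>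

lemma conj_adj_conj_adj_one_fpf:
  assumes n: "even n" and p: "odd p" "p + 2 < n"
  shows "conj_adj p (conj_adj (p + 1) (one_fpf n)) = conj_adj (p + 2) (conj_adj (p + 1) (one_fpf n))"
proof
  fix a
  let ?S = "{p, p + 1, p + 2, p + 3}"
  have "1 \<le> p" using p by (cases p) auto
  then have vals: "one_fpf n p = p + 1" "one_fpf n (p + 1) = p" "one_fpf n (p + 2) = p + 3" "one_fpf n (p + 3) = p + 2"
    using n p by (simp_all add: one_fpf_apply)
  show "conj_adj p (conj_adj (p + 1) (one_fpf n)) a = conj_adj (p + 2) (conj_adj (p + 1) (one_fpf n)) a"
  proof (cases "a \<in> ?S")
    case True
    then consider "a = p" | "a = p + 1" | "a = p + 2" | "a = p + 3" by blast
    then show ?thesis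
      by cases (use vals in \<open>simp_all add: conj_adj_apply adj_transp_apply numeral_3_eq_3\<close>)
  next
    case False
    have "one_fpf n b \<in> ?S" if "b \<in> ?S" for b
      using that vals by auto
    moreover have "one_fpf n (one_fpf n a) = a"
      by (rule involutions_apply[OF fpf_involutions_involutions[OF one_fpf_fpf_involutions[OF n]]])
    ultimately have "one_fpf n a \<notin> ?S"
      using False by metis
    then show ?thesis
      using False by (simp add: conj_adj_apply adj_transp_apply)
  qed
qed

theorem positive_fpf_schubert:
  assumes z: "z \<in> fpf_involutions n"
  shows "positive_int_combination
    (products {var i + var j | i j. 1 \<le> i \<and> i < j \<and> j \<le> n}) (fpf_schubert n z)"
proof -
  let ?G = "{var i + var j | i j. 1 \<le> i \<and> i < j \<and> j \<le> n}"
  have n: "even n" by (rule even_card_fpf[OF z])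
  interpret atom_graph n "fpf_involutions n" "one_fpf n" "fpf_descent n" conj_adj "fpf_atoms n" "\<lambda>_. 0"
    by (rule fpf_atom_graph[OF n])
  let ?\<delta> = "delta id :: (nat \<Rightarrow> nat) \<Rightarrow> int_mpoly"
  \<comment> \<open>An odd generator centralises the base point, so no edge with an odd label leaves
    it. This is why no unpaired factor survives and the vector stays \<open>?\<delta>\<close>
    throughout.\<close>
  have odd_zero: "atom_op i (delta (one_fpf n)) = (\<lambda>y. 0 :: int_mpoly)" if "odd i" for i
  proof
    fix y
    have "y = one_fpf n" if "fpf_descent n i y" "conj_adj i y = one_fpf n"
      using that conj_adj_one_fpf[OF n _ \<open>odd i\<close>] by (metis conj_adj_conj_adj fpf_descent_def)
    then show "atom_op i (delta (one_fpf n)) y = (0 :: int_mpoly)"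
      using not_dsc_base by (auto simp: atom_op_def delta_def)
  qed
  \<comment> \<open>At the base point the odd letter after \<open>2 * k + 2\<close> may be replaced
    by the odd letter on its other side: the terms with a lone odd letter vanish, and the quadratic
    terms agree.\<close>
  have adj: "proj (regular.step n (2 * k + 1) x (regular.step n (2 * k + 2) x ?\<delta>)) =
      proj (regular.step n (2 * k + 3) x (regular.step n (2 * k + 2) x ?\<delta>))" for k x
  proof (cases "2 * k + 2 < n")
    case True
    define p where "p = 2 * k + 1"
    \<comment> \<open>Parity turns \<open>p + 1 < n\<close> into \<open>p + 2 < n\<close>, so both
      odd neighbours of \<open>p + 1\<close> are generators.\<close>
    have "n \<noteq> p + 2"
      using n by (auto simp: p_def)
    then have p: "odd p" "p + 2 < n" "p \<in> {1..<n}" "p + 1 \<in> {1..<n}" "p + 2 \<in> {1..<n}"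
      using True by (auto simp: p_def)
    have lower: "nil_op n p (delta (adj_transp (p + 1))) = (delta (adj_transp (p + 1) \<circ> adj_transp p) :: _ \<Rightarrow> int_mpoly)"
      by (rule nil_op_delta_adj[OF p(3)]) simp
    have upper: "nil_op n (p + 2) (delta (adj_transp (p + 1))) =
        (delta (adj_transp (p + 1) \<circ> adj_transp (p + 2)) :: _ \<Rightarrow> int_mpoly)"
      by (rule nil_op_delta_adj[OF p(5)]) simp
    have lengths: "inversions n (adj_transp (p + 1) \<circ> adj_transp p) = inversions n (adj_transp (p + 1) \<circ> adj_transp (p + 2))"
      using involution_of_adj_adj(2)[OF p(3,4)] involution_of_adj_adj(2)[OF p(5,4)] by simp
    have mem: "adj_transp (p + 1) \<circ> adj_transp p \<in> Sym n" "adj_transp (p + 1) \<circ> adj_transp (p + 2) \<in> Sym n"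
      by (intro Sym_comp Sym_adj_transp p)+
    have "fpf_of n (adj_transp (p + 1)) = conj_adj (p + 1) (one_fpf n)"
      using fpf_of_comp_adj[OF Sym_id, of n "p + 1"] by (simp add: fpf_of_id)
    then have targets: "fpf_of n (adj_transp (p + 1) \<circ> adj_transp p) = fpf_of n (adj_transp (p + 1) \<circ> adj_transp (p + 2))"
      by (simp only: fpf_of_comp_adj[OF Sym_adj_transp[OF p(4)]] conj_adj_conj_adj_one_fpf[OF n p(1,2)])
    have "proj (nil_op n p (nil_op n (p + 1) ?\<delta>)) = proj (nil_op n (p + 2) (nil_op n (p + 1) ?\<delta>))"
    proof
      fix y
      have "adj_transp (p + 1) \<circ> adj_transp p \<in> fpf_atoms n y \<longleftrightarrow> adj_transp (p + 1) \<circ> adj_transp (p + 2) \<in> fpf_atoms n y"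
        if "y \<in> fpf_involutions n"
        unfolding fpf_atoms_eq[OF that] mem_Collect_eq targets lengths using mem by blast
      then show "proj (nil_op n p (nil_op n (p + 1) ?\<delta>)) y = proj (nil_op n (p + 2) (nil_op n (p + 1) ?\<delta>)) y"
        unfolding nil_op_delta_id[OF p(4)] lower upper proj_delta by metis
    qed
    then have "atom_op p (atom_op (p + 1) (proj ?\<delta>)) = atom_op (p + 2) (atom_op (p + 1) (proj ?\<delta>))"
      by (simp only: proj_nil_op)
    moreover have idx: "2 * k + 1 = p" "2 * k + 2 = p + 1" "2 * k + 3 = p + 2"
      by (simp_all add: p_def)
    moreover have "atom_op p (proj ?\<delta>) = (\<lambda>y. 0)" "atom_op (p + 2) (proj ?\<delta>) = (\<lambda>y. 0)"
      unfolding proj_delta_id using p(1) by (intro odd_zero; simp)+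
    ultimately show ?thesis
      unfolding proj_step atomic.step_def atomic.U_lin idx by simp
  next
    case False
    \<comment> \<open>For \<open>n = 2 * k + 2\<close> the letter \<open>2 * k + 1\<close> is still
      a generator, but it kills the base point.\<close>
    then show ?thesis by (simp add: regular.step_vanish proj_step atomic.step_def proj_delta_id odd_zero)
  qed
  \<comment> \<open>The induction moves by two letters: once the part from \<open>2 * k + 3\<close>
    has turned and lost that letter, the exchange above converts the letter \<open>2 * k + 1\<close>
    into precisely the lost one.\<close>
  have turn: "proj (regular.run n (regular.down n (2 * k + 1) x) ?\<delta>) =
      proj (regular.run n (regular.up n (2 * k + 2) x) ?\<delta>)" for k x
  proof (induction "n - 2 * k" arbitrary: k rule: less_induct)
    case less
    show ?case
    proof (cases "2 * k + 1 < n")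
      case True
      have up_rec: "regular.run n (regular.up n (2 * k + 2) x) f = regular.run n (regular.up n (2 * k + 4) x)
          (regular.step n (2 * k + 3) x (regular.step n (2 * k + 2) x f))"
        for f :: "(nat \<Rightarrow> nat) \<Rightarrow> int_mpoly"
        using regular.run_up_rec[of n "2 * k + 2" x f]
          regular.run_up_rec[of n "2 * k + 3" x "regular.step n (2 * k + 2) x f"]
        by (simp add: numeral_eq_Suc)
      have down_rec: "regular.run n (regular.down n (2 * k + 1) x) f = regular.step n (2 * k + 1) x
          (regular.step n (2 * k + 2) x (regular.run n (regular.down n (2 * k + 3) x) f))"
        for f :: "(nat \<Rightarrow> nat) \<Rightarrow> int_mpoly"
        using regular.run_down_rec[of n "2 * k + 1" x f] regular.run_down_rec[of n "2 * k + 2" x f]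
        by (simp add: numeral_eq_Suc)
      have comm: "regular.step n i x (regular.run n (regular.up n (2 * k + 4) x) f) =
          regular.run n (regular.up n (2 * k + 4) x) (regular.step n i x f)"
        if "i \<le> 2 * k + 2" for i and f :: "(nat \<Rightarrow> nat) \<Rightarrow> int_mpoly"
        by (rule regular.run_step_commute[symmetric], unfold regular.fst_set_up) (use that in auto)
      have IH: "proj (regular.run n (regular.down n (2 * k + 3) x) ?\<delta>) =
          proj (regular.run n (regular.up n (2 * k + 4) x) ?\<delta>)"
        using less[of "k + 1"] True by (simp add: numeral_eq_Suc)
      have "proj (regular.run n (regular.down n (2 * k + 1) x) ?\<delta>) =
          proj (regular.step n (2 * k + 1) x (regular.step n (2 * k + 2) x
            (regular.run n (regular.up n (2 * k + 4) x) ?\<delta>)))"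
        unfolding down_rec by (intro proj_step_cong IH)
      also have "\<dots> = proj (regular.run n (regular.up n (2 * k + 4) x)
          (regular.step n (2 * k + 1) x (regular.step n (2 * k + 2) x ?\<delta>)))"
        by (simp add: comm)
      also have "\<dots> = proj (regular.run n (regular.up n (2 * k + 4) x)
          (regular.step n (2 * k + 3) x (regular.step n (2 * k + 2) x ?\<delta>)))"
        by (rule proj_cong[OF adj])
      finally show ?thesis
        by (simp only: up_rec)
    qed (simp add: regular.down_empty regular.up_empty)
  qed
  have "good ?G (proj ?\<delta>)"
    by (auto simp: good_def proj_delta nonneg_one nonneg_combinations.zero)
  then have "positive_int_combination (products ?G) (2 ^ 0 * atom_schubert z)"
    using z turn by (intro positive_atom_schubert[of "\<lambda>_. ?\<delta>"]) force+
  then show ?thesis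
    using z by (simp add: atom_schubert_eq fpf_schubert_def)
qed

theorem corollary2p10:
  fixes n :: nat
  assumes "n \<ge> 1"
  shows "(\<forall>y\<in>involutions n.
            positive_int_combination
              (products {var i + var j | i j. 1 \<le> i \<and> i \<le> j \<and> j \<le> n})
              (2 ^ num_two_cycles n y * inv_schubert n y)) \<and>
         (\<forall>z\<in>fpf_involutions n.
            positive_int_combination
              (products {var i + var j | i j. 1 \<le> i \<and> i < j \<and> j \<le> n})
              (fpf_schubert n z))"
  using positive_inv_schubert positive_fpf_schubert by blast

end
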